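(* Let $\mu\in(0,\infty)$ be a fixed number and let $T\sim F_T$ and $\Lambda\sim F_\Lambda$ be nonnegative random variables. Then, for any fixed number $a>1$, we have $$0\le \mathsf{E}[T]<1,\quad \mathsf{E}[\Lambda]=\frac{-\zeta(a)}{\zeta'(a)}\quad\text{and}\quad \mathsf{E}[\Lambda^2]<\infty$$ if and only if the functional equation $$\hat F(s)=\frac{1}{\zeta(a)}\int_0^\infty\zeta(a+\lambda\,\sigma(s))\,\mathrm{d}F_\Lambda(\lambda),\quad s\ge 0,$$ has exactly one solution $X\sim F$ (a distribution $F$ of a nonnegative random variable $X$) with mean $\mu$ and finite variance. Moreover, in this case, $$\mathsf{Var}[X]=\frac{\zeta''(a)\,\mathsf{E}[\Lambda^2]-\zeta(a)+\zeta(a)\,\mathsf{E}[T]}{\zeta(a)(1-\mathsf{E}[T])}\,\mu^2 .$$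
   Context: $\zeta(s)=\sum_{n=1}^\infty n^{-s}$, $s>1$, is the Riemann zeta function. For a nonnegative random variable $Y$, $Y\sim F_Y$ means that $Y$ has distribution function $F_Y$, and $\hat F_Y(s)=\mathsf{E}[e^{-sY}]=\int_0^\infty e^{-sy}\,\mathrm{d}F_Y(y)$, $s\ge0$, is its Laplace–Stieltjes transform. Integrals $\int_0^\infty$ with respect to distributions include a possible atom at $0$. For a distribution $F$ on $[0,\infty)$ with mean $\mu\in(0,\infty)$ (the unknown of the equation), define $$\sigma(s)=\int_0^\infty\frac{1-\hat F(ts)}{t}\,\mathrm{d}F_T(t),\quad s\ge0,$$ where the integrand at $t=0$ is defined by continuity to be $\mu s$. Equivalently, $\sigma(s)=\mu\int_0^s\hat F_{TZ}(x)\,\mathrm{d}x$, where $Z$ is independent of $T$ and has the length-biased distribution $F_Z(z)=\frac1\mu\int_0^z x\,\mathrm{d}F(x)$, $z\ge0$. Note that $\sigma$ depends on the unknown $F$. *)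

theory Defs
  imports "HOL-Probability.Probability"
begin

text \<open>Only meaningful for \<open>s > 1\<close>, where the series converges; it is never evaluated elsewhere,
  and \<open>{1<..}\<close> is open, so \<open>deriv\<close> at points \<open>a > 1\<close> sees only the genuine function.\<close>

definition zeta :: "real \<Rightarrow> real" where
  "zeta s = (\<Sum>n. real (Suc n) powr (- s))"

text \<open>A probability distribution on \<open>[0, \<infinity>)\<close>, represented by its Borel measure on the real line.\<close>

definition nonneg_distribution :: "real measure \<Rightarrow> bool" where
  "nonneg_distribution F \<longleftrightarrow> real_distribution F \<and> (AE x in F. 0 \<le> x)"

definition laplace_stieltjes :: "real measure \<Rightarrow> real \<Rightarrow> real" where
  "laplace_stieltjes F s = (LINT y:{0..}|F. exp (- s * y))"

definition mean :: "real measure \<Rightarrow> real" where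
  "mean F = prob_space.expectation F (\<lambda>x. x)"

text \<open>The value of the integrand at \<open>t = 0\<close> is its limit as \<open>t\<close> tends to \<open>0\<close> from the right.\<close>

definition sigma :: "real measure \<Rightarrow> real measure \<Rightarrow> real \<Rightarrow> real" where
  "sigma FT F s =
    (LINT t:{0..}|FT. if t = 0 then mean F * s else (1 - laplace_stieltjes F (t * s)) / t)"

definition satisfies_equation ::
    "real \<Rightarrow> real measure \<Rightarrow> real measure \<Rightarrow> real measure \<Rightarrow> bool" where
  "satisfies_equation a FT FL F \<longleftrightarrow>
    (\<forall>s\<ge>0. laplace_stieltjes F s =
       1 / zeta a * (LINT l:{0..}|FL. zeta (a + l * sigma FT F s)))"

text \<open>The integrability conjuncts say that the first two moments are finite; without them the
  Bochner integral in \<^const>\<open>mean\<close> would be \<open>0\<close> by convention.\<close>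

definition is_solution ::
    "real \<Rightarrow> real \<Rightarrow> real measure \<Rightarrow> real measure \<Rightarrow> real measure \<Rightarrow> bool" where
  "is_solution a \<mu> FT FL F \<longleftrightarrow>
    nonneg_distribution F \<and>
    integrable F (\<lambda>x. x) \<and> mean F = \<mu> \<and>
    integrable F (\<lambda>x. x\<^sup>2) \<and>
    satisfies_equation a FT FL F"

end

theory Submission
  imports Defs "HOL-Real_Asymp.Real_Asymp"
begin

text \<open>
The function \<open>\<zeta>\<close> enters only through one law. If \<open>N = n\<close> with probability \<open>n\<^sup>-\<^sup>a / \<zeta>(a)\<close>, then
\<open>\<zeta>(a + \<lambda> x) / \<zeta>(a) = E (exp (- \<lambda> x log N))\<close>. So the functional equation reads \<open>\<phi> = \<gamma> \<circ> \<sigma>\<close>, where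
\<open>\<phi>\<close> is the transform of \<open>F\<close> and \<open>\<gamma>\<close> the transform of the law \<open>G\<close> of \<open>A = \<Lambda> log N\<close>
(\<open>zeta_mixture_exists\<close>). Moreover \<open>E A = - \<zeta>'(a) / \<zeta>(a) * E \<Lambda>\<close> and
\<open>E A\<^sup>2 = \<zeta>''(a) / \<zeta>(a) * E \<Lambda>\<^sup>2\<close>. The claim becomes: there is exactly one solution with mean \<open>\<mu>\<close> and finite
variance if and only if \<open>E A = 1\<close>, \<open>E A\<^sup>2 < \<infinity>\<close> and \<open>E T < 1\<close> (\<open>unique_fixed_law_iff\<close>).

Necessity comes from expanding the equation at \<open>s = 0\<close>. The first order gives \<open>\<mu> = E A * \<mu>\<close>, the second order
\<open>E X\<^sup>2 = \<mu>\<^sup>2 * E A\<^sup>2 + E T * E X\<^sup>2\<close>, from which both \<open>E T < 1\<close> and the formula for the variance follow. The moments of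
\<open>A\<close> and \<open>T\<close> are not known to be finite beforehand; this is Fatou's lemma applied to difference quotients of
the transforms (\<open>fixed_law_necessary\<close>).

Uniqueness holds because the equation contracts the distance \<open>sup \<bar>\<phi>\<^sub>1 s - \<phi>\<^sub>2 s\<bar> / s\<^sup>2\<close> by the factor
\<open>E T\<close> (\<open>sigma_contraction\<close>).

For existence, the equation is iterated from the point mass at \<open>\<mu>\<close>. A step is possible because \<open>\<gamma> \<circ> \<sigma>\<close> is again a
transform: it is a limit of transforms of compound Poisson laws with a random intensity
(\<open>equation_operator_exists\<close>). The transforms of the iterates increase, the mean stays \<open>\<mu>\<close> and the second
moments stay bounded, so the continuity theorem for transforms gives a limit law, and it solves the
equation (\<open>fixed_law_exists\<close>).
\<close>

section \<open>Laplace--Stieltjes transforms of distributions on the half line\<close>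

lemma nonneg_distributionI:
  assumes "prob_space F" "sets F = sets borel" "AE x in F. 0 \<le> x"
  shows "nonneg_distribution F"
  using assms unfolding nonneg_distribution_def real_distribution_def real_distribution_axioms_def by auto

lemma nonneg_distributionD:
  assumes "nonneg_distribution F"
  shows "real_distribution F" "prob_space F" "finite_measure F" "sigma_finite_measure F"
    "sets F = sets borel" "space F = UNIV" "AE x in F. 0 \<le> x"
proof -
  show F: "real_distribution F" and "AE x in F. 0 \<le> x"
    using assms by (auto simp: nonneg_distribution_def)
  interpret real_distribution F by fact
  show "prob_space F" "finite_measure F" "sigma_finite_measure F" "sets F = sets borel" "space F = UNIV"
    by (auto intro: prob_space_axioms finite_measure_axioms sigma_finite_measure_axioms)
qed

lemma nonneg_distribution_measurable:
  "nonneg_distribution F \<Longrightarrow> f \<in> borel_measurable borel \<Longrightarrow> f \<in> borel_measurable F"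
  by (subst measurable_cong_sets[OF nonneg_distributionD(5) refl]) auto

lemma nonneg_distribution_distr:
  assumes "prob_space M" "X \<in> borel_measurable M" "AE w in M. 0 \<le> X w"
  shows "nonneg_distribution (distr M borel X)"
  using assms by (intro nonneg_distributionI prob_space.prob_space_distr) (auto simp: AE_distr_iff)

lemma set_integral_nonneg_distribution:
  assumes F: "nonneg_distribution F" and f: "f \<in> borel_measurable borel"
  shows "(LINT x:{0..}|F. f x) = (\<integral>x. f x \<partial>F)"
  unfolding set_lebesgue_integral_def
  by (rule integral_cong_AE)
    (use nonneg_distributionD(7)[OF F] in \<open>auto intro!: nonneg_distribution_measurable[OF F] f
      borel_measurable_scaleR borel_measurable_indicator\<close>)

lemma laplace_stieltjes_eq:
  "nonneg_distribution F \<Longrightarrow> laplace_stieltjes F s = (\<integral>y. exp (- s * y) \<partial>F)"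
  unfolding laplace_stieltjes_def by (rule set_integral_nonneg_distribution) auto

lemma nonneg_distribution_integrable_bounded:
  assumes F: "nonneg_distribution F" and f: "f \<in> borel_measurable borel"
    and b: "\<And>x. 0 \<le> x \<Longrightarrow> \<bar>f x\<bar> \<le> (B::real)"
  shows "integrable F f"
proof -
  interpret prob_space F using F by (rule nonneg_distributionD)
  show ?thesis
    by (rule integrable_const_bound[of _ B])
      (use nonneg_distributionD(7)[OF F] b in \<open>auto intro!: nonneg_distribution_measurable[OF F] f\<close>)
qed

lemma integrable_exp_nonneg_distribution:
  "nonneg_distribution F \<Longrightarrow> 0 \<le> s \<Longrightarrow> integrable F (\<lambda>y. exp (- s * y))"
  by (rule nonneg_distribution_integrable_bounded[of _ _ 1]) auto

lemma nn_integral_exp_nonneg_distribution: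
  assumes "nonneg_distribution F" "0 \<le> s"
  shows "(\<integral>\<^sup>+y. ennreal (exp (- s * y)) \<partial>F) = ennreal (laplace_stieltjes F s)"
  unfolding laplace_stieltjes_eq[OF assms(1)]
  by (rule nn_integral_eq_integral[OF integrable_exp_nonneg_distribution[OF assms]]) auto

lemma laplace_stieltjes_bounds:
  assumes F: "nonneg_distribution F" and s: "0 \<le> s"
  shows "0 \<le> laplace_stieltjes F s" "laplace_stieltjes F s \<le> 1"
proof -
  interpret prob_space F using F by (rule nonneg_distributionD)
  show "0 \<le> laplace_stieltjes F s"
    by (simp add: laplace_stieltjes_eq[OF F])
  have "(\<integral>y. exp (- s * y) \<partial>F) \<le> (\<integral>y. 1 \<partial>F)"
    by (rule integral_mono_AE[OF integrable_exp_nonneg_distribution[OF F s]])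
      (use nonneg_distributionD(7)[OF F] s in auto)
  then show "laplace_stieltjes F s \<le> 1"
    by (simp add: laplace_stieltjes_eq[OF F] prob_space)
qed

lemma borel_measurable_laplace_stieltjes:
  assumes F: "nonneg_distribution F"
  shows "laplace_stieltjes F \<in> borel_measurable borel"
proof -
  interpret sigma_finite_measure F using F by (rule nonneg_distributionD)
  have [measurable_cong]: "sets F = sets borel" using F by (rule nonneg_distributionD)
  have "(\<lambda>s. \<integral>y. exp (- s * y) \<partial>F) \<in> borel_measurable borel"
    by (rule borel_measurable_lebesgue_integral) measurable
  then show ?thesis
    by (simp add: laplace_stieltjes_eq[OF F, abs_def] cong: measurable_cong)
qed

lemma laplace_stieltjes_antimono:
  assumes F: "nonneg_distribution F" and s: "0 \<le> s" "s \<le> t"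
  shows "laplace_stieltjes F t \<le> laplace_stieltjes F s"
  unfolding laplace_stieltjes_eq[OF F]
  by (rule integral_mono_AE) 
    (use nonneg_distributionD(7)[OF F] s in \<open>auto intro!: integrable_exp_nonneg_distribution[OF F, simplified] mult_right_mono\<close>)

lemma laplace_stieltjes_Lipschitz:
  assumes F: "nonneg_distribution F" and m: "integrable F (\<lambda>x. x)" and st: "0 \<le> s" "0 \<le> t"
  shows "\<bar>laplace_stieltjes F s - laplace_stieltjes F t\<bar> \<le> mean F * \<bar>s - t\<bar>"
proof -
  interpret prob_space F using F by (rule nonneg_distributionD)
  have *: "exp (- s * x) - exp (- t * x) \<le> x * (t - s)"
    if "0 \<le> s" "s \<le> t" "0 \<le> x" for s t x :: real
  proof -
    have "exp (- s * x) - exp (- t * x) = exp (- s * x) * (1 - exp (- ((t - s) * x)))"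
      by (simp add: algebra_simps flip: exp_add)
    also have "\<dots> \<le> 1 * ((t - s) * x)"
      using that exp_ge_add_one_self[of "- ((t - s) * x)"] by (intro mult_mono) auto
    finally show ?thesis by (simp add: mult_ac)
  qed
  have wlog: "\<bar>laplace_stieltjes F s - laplace_stieltjes F t\<bar> \<le> mean F * \<bar>s - t\<bar>"
    if st: "0 \<le> s" "s \<le> t" for s t
  proof -
    have "laplace_stieltjes F s - laplace_stieltjes F t = (\<integral>x. exp (- s * x) - exp (- t * x) \<partial>F)"
      using st by (simp only: laplace_stieltjes_eq[OF F])
        (rule Bochner_Integration.integral_diff[symmetric]; rule integrable_exp_nonneg_distribution[OF F]; simp)
    also have "\<dots> \<le> (\<integral>x. x * (t - s) \<partial>F)"
      by (rule integral_mono_AE)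
        (use st nonneg_distributionD(7)[OF F] in \<open>auto intro!: m integrable_exp_nonneg_distribution[OF F, simplified]
           Bochner_Integration.integrable_diff *[simplified]\<close>)
    finally show ?thesis
      using laplace_stieltjes_antimono[OF F st] st by (simp add: mean_def)
  qed
  show ?thesis
    using wlog[of s t] wlog[of t s] st by (cases "s \<le> t") (auto simp: abs_minus_commute)
qed

lemma laplace_stieltjes_0: "nonneg_distribution F \<Longrightarrow> laplace_stieltjes F 0 = 1"
  using prob_space.prob_space[OF nonneg_distributionD(2), of F] by (simp add: laplace_stieltjes_eq)

lemma mean_nonneg: "nonneg_distribution F \<Longrightarrow> 0 \<le> mean F"
  unfolding mean_def by (rule integral_nonneg_AE) (rule nonneg_distributionD)

lemma one_minus_laplace_stieltjes_le:
  assumes "nonneg_distribution F" "integrable F (\<lambda>x. x)" "0 \<le> s"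
  shows "1 - laplace_stieltjes F s \<le> mean F * s"
  using laplace_stieltjes_Lipschitz[OF assms(1,2) order_refl assms(3)] assms(3)
  by (simp add: laplace_stieltjes_0[OF assms(1)])

section \<open>Uniqueness and continuity of the transform\<close>

text \<open>The exponential series may be integrated term by term because its terms are dominated by
\<open>\<bar>t\<bar>\<^sup>n / n!\<close> on \<open>[0, 1]\<close>. Hence the moments of a law on
\<open>[0, 1]\<close> determine its characteristic function.\<close>

lemma char_eq_moment_series:
  assumes N: "prob_space N" "sets N = sets borel" and b: "AE y in N. 0 \<le> y \<and> y \<le> (1::real)"
  shows "(\<lambda>n. (\<i> * complex_of_real t) ^ n / fact n * complex_of_real (\<integral>y. y ^ n \<partial>N)) sums char N t"
proof -
  interpret prob_space N by fact
  have [measurable_cong]: "sets N = sets borel" by fact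
  let ?f = "\<lambda>n y. (\<i> * complex_of_real t) ^ n / fact n * complex_of_real (y ^ n)"
  have nrm: "norm (?f n y) = \<bar>t\<bar> ^ n / fact n * \<bar>y\<bar> ^ n" for n y
    by (simp add: norm_mult norm_divide norm_power power_abs)
  have le: "norm (?f n y) \<le> \<bar>t\<bar> ^ n / fact n" if "0 \<le> y" "y \<le> 1" for n y
    unfolding nrm using that power_le_one[of y n] by (intro mult_left_le) auto
  have int: "integrable N (?f n)" for n
    by (rule integrable_const_bound[of _ "\<bar>t\<bar> ^ n / fact n"]) (use b le in auto)
  have summ: "summable (\<lambda>n. \<bar>t\<bar> ^ n / fact n)"
    using summable_exp[of "\<bar>t\<bar>"] by (simp add: field_simps)
  have "(\<lambda>n. integral\<^sup>L N (?f n)) sums (\<integral>y. (\<Sum>n. ?f n y) \<partial>N)"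
  proof (rule sums_integral[OF int])
    show "AE y in N. summable (\<lambda>n. norm (?f n y))"
      using b by eventually_elim (rule summable_comparison_test'[OF summ, of 0], use le in auto)
    show "summable (\<lambda>n. \<integral>y. norm (?f n y) \<partial>N)"
    proof (rule summable_comparison_test'[OF summ, of 0])
      fix n :: nat
      have "(\<integral>y. norm (?f n y) \<partial>N) \<le> (\<integral>y. \<bar>t\<bar> ^ n / fact n \<partial>N)"
        by (rule integral_mono_AE) (use b le int in \<open>auto intro!: integrable_norm\<close>)
      then show "norm (\<integral>y. norm (?f n y) \<partial>N) \<le> \<bar>t\<bar> ^ n / fact n"
        by (simp add: prob_space del: nrm)
    qed
  qed
  also have "(\<lambda>y. \<Sum>n. ?f n y) = (\<lambda>y. iexp (t * y))"
  proof
    fix y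
    have "(\<lambda>n. (\<i> * complex_of_real (t * y)) ^ n /\<^sub>R fact n) sums exp (\<i> * complex_of_real (t * y))"
      by (rule exp_converges)
    then show "(\<Sum>n. ?f n y) = iexp (t * y)"
      by (intro sums_unique[symmetric]) (simp add: scaleR_conv_of_real field_simps power_mult_distrib)
  qed
  also have "(\<lambda>n. integral\<^sup>L N (?f n)) = (\<lambda>n. (\<i> * complex_of_real t) ^ n / fact n * complex_of_real (\<integral>y. y ^ n \<partial>N))"
    by (subst integral_mult_right_zero) (simp only: integral_complex_of_real)
  finally show ?thesis by (simp add: char_def)
qed

text \<open>If \<open>X\<close> has law \<open>F\<close>, then the moments of \<open>exp (- X)\<close> are the values of the transform of
\<open>F\<close> at the integers. As \<open>exp (- X)\<close> lies in \<open>[0, 1]\<close>, these moments determine its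
characteristic function, hence its law, hence \<open>F\<close>.\<close>

theorem laplace_stieltjes_unique:
  assumes F: "nonneg_distribution F" and G: "nonneg_distribution G"
    and eq: "\<And>s. 0 \<le> s \<Longrightarrow> laplace_stieltjes F s = laplace_stieltjes G s"
  shows "F = G"
proof -
  define N where "N H = distr H borel (\<lambda>x::real. exp (- x))" for H
  have N: "prob_space (N H)" "sets (N H) = sets borel" "AE y in N H. 0 \<le> y \<and> y \<le> 1"
      "(\<integral>y. y ^ n \<partial>N H) = laplace_stieltjes H (real n)" "distr (N H) borel (\<lambda>y. - ln y) = H"
    if H: "nonneg_distribution H" for H n
  proof -
    have [measurable_cong]: "sets H = sets borel" using H by (rule nonneg_distributionD)
    interpret prob_space H using H by (rule nonneg_distributionD)
    show "prob_space (N H)" unfolding N_def by (rule prob_space_distr) measurable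
    show "sets (N H) = sets borel" by (simp add: N_def)
    show "AE y in N H. 0 \<le> y \<and> y \<le> 1"
      unfolding N_def using nonneg_distributionD(7)[OF H] by (subst AE_distr_iff) auto
    have "(\<integral>y. y ^ n \<partial>N H) = (\<integral>x. exp (- x) ^ n \<partial>H)"
      unfolding N_def by (rule integral_distr) measurable
    then show "(\<integral>y. y ^ n \<partial>N H) = laplace_stieltjes H (real n)"
      by (simp add: laplace_stieltjes_eq[OF H] flip: exp_of_nat_mult)
    have "distr (N H) borel (\<lambda>y. - ln y) = distr H borel ((\<lambda>y. - ln y) \<circ> (\<lambda>x. exp (- x)))"
      unfolding N_def by (rule distr_distr) measurable
    also have "\<dots> = distr H H (\<lambda>x. x)"
      by (rule distr_cong) (auto simp: nonneg_distributionD(5)[OF H])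
    finally show "distr (N H) borel (\<lambda>y. - ln y) = H" by simp
  qed
  have "char (N F) = char (N G)"
  proof
    fix t
    have "(\<lambda>n. (\<i> * complex_of_real t) ^ n / fact n * complex_of_real (\<integral>y. y ^ n \<partial>N F)) sums char (N F) t"
      by (rule char_eq_moment_series[OF N(1-3)[OF F]])
    moreover have "(\<lambda>n. (\<i> * complex_of_real t) ^ n / fact n * complex_of_real (\<integral>y. y ^ n \<partial>N F)) sums char (N G) t"
      unfolding N(4)[OF F] eq[OF of_nat_0_le_iff] N(4)[OF G, symmetric]
      by (rule char_eq_moment_series[OF N(1-3)[OF G]])
    ultimately show "char (N F) t = char (N G) t" by (rule sums_unique2)
  qed
  then have "N F = N G"
    by (intro Levy_uniqueness) (auto simp: real_distribution_def real_distribution_axioms_def N F G)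
  then have "distr (N F) borel (\<lambda>y. - ln y) = distr (N G) borel (\<lambda>y. - ln y)" by (rule arg_cong)
  then show ?thesis
    unfolding N(5)[OF F] N(5)[OF G] .
qed

text \<open>Markov's inequality for \<open>1 - exp (- X / b)\<close>, which is at least \<open>1 - exp (- 1)\<close> when \<open>X > b\<close>.
It turns a bound on the transform near \<open>0\<close> into tightness.\<close>

lemma laplace_tail_bound:
  assumes F: "nonneg_distribution F" and b: "0 < b"
  shows "measure F {b<..} * (1 - exp (-1)) \<le> 1 - laplace_stieltjes F (1 / b)"
proof -
  interpret prob_space F using F by (rule nonneg_distributionD)
  have [measurable_cong]: "sets F = sets borel" using F by (rule nonneg_distributionD)
  have i: "integrable F (\<lambda>x. exp (- (1 / b) * x))"
    using b by (intro integrable_exp_nonneg_distribution[OF F]) auto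
  have "measure F {b<..} * (1 - exp (-1)) = (\<integral>x. indicator {b<..} x * (1 - exp (-1)) \<partial>F)"
    by (simp add: nonneg_distributionD(6)[OF F])
  also have "\<dots> \<le> (\<integral>x. 1 - exp (- (1 / b) * x) \<partial>F)"
  proof (rule integral_mono_AE)
    show "AE x in F. indicator {b<..} x * (1 - exp (- 1)) \<le> 1 - exp (- (1 / b) * x)"
      using nonneg_distributionD(7)[OF F] by eventually_elim (use b in \<open>auto split: split_indicator\<close>)
  qed (use i in \<open>auto intro!: integrable_real_mult_indicator Bochner_Integration.integrable_diff simp del: mult_minus_left simp: emeasure_eq_measure\<close>)
  also have "\<dots> = 1 - laplace_stieltjes F (1 / b)"
    using i by (simp add: laplace_stieltjes_eq[OF F] prob_space)
  finally show ?thesis .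
qed

text \<open>A linear bound on \<open>1 - \<phi>\<^sub>n\<close> that is uniform in \<open>n\<close> makes the laws tight; by Helly's theorem some
subsequence converges weakly, and its limit has the transform \<open>\<phi>\<close>.\<close>

theorem laplace_stieltjes_continuity:
  assumes F: "\<And>n. nonneg_distribution (F n)"
    and lim: "\<And>s. 0 \<le> s \<Longrightarrow> (\<lambda>n. laplace_stieltjes (F n) s) \<longlonglongrightarrow> \<phi> s"
    and tight: "\<And>n s. 0 \<le> s \<Longrightarrow> 1 - laplace_stieltjes (F n) s \<le> C * s"
  obtains H where "nonneg_distribution H" "\<And>s. 0 \<le> s \<Longrightarrow> laplace_stieltjes H s = \<phi> s"
proof -
  have meas: "{a<..b} \<in> sets (F n)" "{b<..} \<in> sets (F n)" "{..b} \<in> sets (F n)" for a b :: real and n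
    by (simp_all add: nonneg_distributionD(5)[OF F])
  have "tight F"
    unfolding tight_def
  proof (intro conjI allI impI)
    show "real_distribution (F n)" for n using F by (rule nonneg_distributionD)
    fix \<epsilon> :: real assume \<epsilon>: "0 < \<epsilon>"
    \<comment> \<open>large enough for \<open>\<bar>C\<bar> / b < \<epsilon> * (1 - exp (- 1))\<close>; the summand \<open>1\<close> keeps it above \<open>- 1\<close>\<close>
    define b where "b = 1 + (\<bar>C\<bar> + 1) / (\<epsilon> * (1 - exp (-1)))"
    have e: "0 < 1 - exp (-1 :: real)" by simp
    have b: "0 < b" using \<epsilon> e by (simp add: b_def add_pos_nonneg)
    have "measure (F n) {-1<..b} > 1 - \<epsilon>" for n
    proof -
      interpret prob_space "F n" using F by (rule nonneg_distributionD)
      have "measure (F n) {b<..} * (1 - exp (-1)) \<le> C / b"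
        using laplace_tail_bound[OF F b, of n] tight[of "1/b" n] b by (auto intro: order_trans)
      also have "\<dots> \<le> \<bar>C\<bar> / b"
        using b by (intro divide_right_mono) auto
      also have "\<dots> < \<epsilon> * (1 - exp (-1))"
      proof -
        have "\<epsilon> * (1 - exp (-1)) * b = \<epsilon> * (1 - exp (-1)) + (\<bar>C\<bar> + 1)"
          using \<epsilon> e by (simp add: b_def field_simps del: diff_gt_0_iff_gt)
        then show ?thesis
          using b \<epsilon> e by (subst pos_divide_less_eq) (auto intro: add_nonneg_pos mult_pos_pos)
      qed
      finally have "measure (F n) {b<..} < \<epsilon>"
        using e by (simp only: mult_less_cancel_right_pos)
      moreover have "measure (F n) ({-1<..b} \<union> {b<..}) = 1"
      proof (subst prob_eq_1)
        show "AE x in F n. x \<in> {-1<..b} \<union> {b<..}"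
          using nonneg_distributionD(7)[OF F, of n] by eventually_elim auto
      qed (use meas in auto)
      ultimately show ?thesis
        using measure_Un_le[OF meas(1)[of "-1" b n] meas(2)[of b n]] by linarith
    qed
    then show "\<exists>a b. a < b \<and> (\<forall>n. 1 - \<epsilon> < measure (F n) {a<..b})"
      using b by (intro exI[of _ "-1"] exI[of _ b]) auto
  qed
  from tight_imp_convergent_subsubsequence[OF this strict_mono_id]
  obtain r H where r: "strict_mono (r :: nat \<Rightarrow> nat)" and H: "real_distribution H" and w: "weak_conv_m (F \<circ> id \<circ> r) H"
    by auto
  interpret H: real_distribution H by fact
  have rd: "real_distribution ((F \<circ> id \<circ> r) n)" for n
    using F by (auto intro: nonneg_distributionD)
  \<comment> \<open>Weak convergence needs a test function that is bounded and continuous on the whole line, so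
\<open>x\<close> is replaced by \<open>max 0 x\<close>; under each \<open>F n\<close> this changes nothing almost surely.\<close>
  have clip: "(\<integral>x. exp (- s * max 0 x) \<partial>H) = \<phi> s" if s: "0 \<le> s" for s
  proof (rule LIMSEQ_unique)
    show "(\<lambda>n. \<integral>x. exp (- s * max 0 x) \<partial>((F \<circ> id \<circ> r) n)) \<longlonglongrightarrow> (\<integral>x. exp (- s * max 0 x) \<partial>H)"
      by (rule weak_conv_imp_integral_bdd_continuous_conv[OF rd H w, of _ 1])
        (use s in \<open>auto intro!: continuous_intros continuous_max\<close>)
    have "(\<integral>x. exp (- s * max 0 x) \<partial>((F \<circ> id \<circ> r) n)) = laplace_stieltjes (F (r n)) s" for n
      unfolding laplace_stieltjes_eq[OF F] comp_def id_def
    proof (rule integral_cong_AE)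
      show "AE x in F (r n). exp (- s * max 0 x) = exp (- s * x)"
        using nonneg_distributionD(7)[OF F, of "r n"] by eventually_elim simp
    qed (auto intro!: nonneg_distribution_measurable[OF F])
    then show "(\<lambda>n. \<integral>x. exp (- s * max 0 x) \<partial>((F \<circ> id \<circ> r) n)) \<longlonglongrightarrow> \<phi> s"
      using LIMSEQ_subseq_LIMSEQ[OF lim[OF s] r] by (simp add: comp_def)
  qed
  have H': "nonneg_distribution (distr H borel (max 0))"
    by (rule nonneg_distribution_distr) (auto intro: H.prob_space_axioms)
  show ?thesis
  proof (rule that[OF H'])
    fix s :: real assume s: "0 \<le> s"
    have "laplace_stieltjes (distr H borel (max 0)) s = (\<integral>x. exp (- s * max 0 x) \<partial>H)"
      unfolding laplace_stieltjes_eq[OF H'] by (rule integral_distr) auto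
    then show "laplace_stieltjes (distr H borel (max 0)) s = \<phi> s"
      using clip[OF s] by simp
  qed
qed

section \<open>Moments as limits of difference quotients at zero\<close>

text \<open>Fatou's lemma. It is how finiteness of a moment is deduced: the difference quotients of a transform are
integrals of nonnegative functions that converge pointwise to a power of the variable.\<close>

lemma integrable_of_bounded_integrals_tendsto:
  fixes f :: "'a \<Rightarrow> real"
  assumes h: "\<And>n. integrable N (h n)" "\<And>n. AE x in N. 0 \<le> h n x"
    and f: "f \<in> borel_measurable N" and lim: "AE x in N. (\<lambda>n. h n x) \<longlonglongrightarrow> f x"
    and B: "\<And>n. (\<integral>x. h n x \<partial>N) \<le> B"
  shows "integrable N f"
proof (rule integrableI_bounded[OF f])
  have nn: "AE x in N. \<forall>n. 0 \<le> h n x" using h(2) by (simp add: AE_all_countable)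
  have "(\<integral>\<^sup>+x. ennreal (norm (f x)) \<partial>N) = (\<integral>\<^sup>+x. liminf (\<lambda>n. ennreal (h n x)) \<partial>N)"
  proof (rule nn_integral_cong_AE)
    show "AE x in N. ennreal (norm (f x)) = liminf (\<lambda>n. ennreal (h n x))"
      using lim nn
    proof eventually_elim
      fix x assume l: "(\<lambda>n. h n x) \<longlonglongrightarrow> f x" and p: "\<forall>n. 0 \<le> h n x"
      have "0 \<le> f x" by (rule LIMSEQ_le_const[OF l]) (use p in auto)
      moreover have "(\<lambda>n. ennreal (h n x)) \<longlonglongrightarrow> ennreal (f x)" using l by (rule tendsto_ennrealI)
      ultimately show "ennreal (norm (f x)) = liminf (\<lambda>n. ennreal (h n x))"
        using lim_imp_Liminf[OF sequentially_bot, of "\<lambda>n. ennreal (h n x)"] by simp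
    qed
  qed
  also have "\<dots> \<le> liminf (\<lambda>n. \<integral>\<^sup>+x. ennreal (h n x) \<partial>N)"
    using h(1) by (intro nn_integral_liminf) auto
  also have "\<dots> \<le> liminf (\<lambda>n. ennreal B)"
    by (rule Liminf_mono) (use h B in \<open>auto intro!: always_eventually ennreal_leI simp: nn_integral_eq_integral\<close>)
  also have "\<dots> < \<infinity>" by (simp add: Liminf_const)
  finally show "(\<integral>\<^sup>+x. ennreal (norm (f x)) \<partial>N) < \<infinity>" .
qed

lemma exp_minus_le_quadratic:
  assumes "0 \<le> (u::real)"
  shows "exp (- u) \<le> 1 - u + u\<^sup>2 / 2"
proof -
  define f where "f u = 1 - u + u\<^sup>2 / 2 - exp (- u)" for u :: real
  have "f 0 \<le> f u"
  proof (rule DERIV_nonneg_imp_nondecreasing[OF assms])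
    fix x :: real
    have "(f has_real_derivative (x - (1 - exp (- x)))) (at x)"
      unfolding f_def[abs_def] by (auto intro!: derivative_eq_intros)
    moreover have "0 \<le> x - (1 - exp (- x))"
      using exp_ge_add_one_self[of "- x"] by simp
    ultimately show "\<exists>y. (f has_real_derivative y) (at x) \<and> 0 \<le> y" by blast
  qed
  then show ?thesis by (simp add: f_def)
qed

lemma tendsto_exp_kernel1:
  "((\<lambda>u. (1 - exp (- u * x)) / u) \<longlongrightarrow> (x::real)) (at_right 0)"
  by real_asymp

lemma tendsto_exp_kernel2:
  "((\<lambda>u. (exp (- u * x) - 1 + u * x) / u\<^sup>2) \<longlongrightarrow> (x::real)\<^sup>2 / 2) (at_right 0)"
proof (cases "x = 0")
  case False
  then have "((\<lambda>u. (exp (- u * x) - 1 + u * x) / u\<^sup>2) \<longlongrightarrow> x * x / 2) (at_right 0)"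
    by real_asymp
  then show ?thesis by (simp only: power2_eq_square)
qed simp

lemma filterlim_at_right_0_seq:
  assumes "\<And>n. 0 < (u n :: real)" "u \<longlonglongrightarrow> 0"
  shows "filterlim u (at_right 0) sequentially"
proof -
  have "u n \<in> {0<..} \<and> u n \<noteq> 0" for n using assms(1)[of n] by auto
  then show ?thesis using assms(2) by (auto simp: filterlim_at)
qed

context
  fixes F :: "real measure" and u :: "nat \<Rightarrow> real"
  assumes F: "nonneg_distribution F" and u_pos: "\<And>n. 0 < u n" and u_lim: "u \<longlonglongrightarrow> 0"
begin

interpretation F: real_distribution F using F by (rule nonneg_distributionD)

lemma integral_exp_kernel1:
  "integrable F (\<lambda>x. (1 - exp (- u n * x)) / u n)"
  "(\<integral>x. (1 - exp (- u n * x)) / u n \<partial>F) = (1 - laplace_stieltjes F (u n)) / u n"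
  using integrable_exp_nonneg_distribution[OF F, of "u n"] u_pos[of n]
  by (auto simp: laplace_stieltjes_eq[OF F] F.prob_space[simplified])

text \<open>Dominated convergence, as \<open>(1 - exp (- u x)) / u\<close> increases to \<open>x\<close> when \<open>u\<close> decreases to \<open>0\<close>.\<close>

lemma laplace_quotient_tendsto_mean:
  assumes m: "integrable F (\<lambda>x. x)"
  shows "(\<lambda>n. (1 - laplace_stieltjes F (u n)) / u n) \<longlonglongrightarrow> mean F"
proof -
  have "(\<lambda>n. \<integral>x. (1 - exp (- u n * x)) / u n \<partial>F) \<longlonglongrightarrow> (\<integral>x. x \<partial>F)"
  proof (rule integral_dominated_convergence[where w = "\<lambda>x. x"])
    show "integrable F (\<lambda>x. x)" by (rule m)
    show "(\<lambda>x. (1 - exp (- u n * x)) / u n) \<in> borel_measurable F" for n by measurable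
    show "(\<lambda>x. x) \<in> borel_measurable F" by measurable
  show "AE x in F. (\<lambda>n. (1 - exp (- u n * x)) / u n) \<longlonglongrightarrow> x"
    by (intro AE_I2 filterlim_compose[OF tendsto_exp_kernel1 filterlim_at_right_0_seq[OF u_pos u_lim]])
  show "AE x in F. norm ((1 - exp (- u n * x)) / u n) \<le> x" for n
    using nonneg_distributionD(7)[OF F]
  proof eventually_elim
    fix x :: real assume x: "0 \<le> x"
    have "1 - exp (- u n * x) \<le> u n * x" "0 \<le> 1 - exp (- u n * x)"
      using exp_ge_add_one_self[of "- u n * x"] x u_pos[of n] by (auto intro: less_imp_le)
    then show "norm ((1 - exp (- u n * x)) / u n) \<le> x"
      using u_pos[of n] by (simp add: abs_of_nonneg pos_divide_le_eq mult.commute)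
    qed
  qed
  then show ?thesis
    unfolding integral_exp_kernel1(2) mean_def .
qed

text \<open>Converse to the preceding limit: a transform with bounded first-order quotients at \<open>0\<close> belongs to a law
with a finite mean.\<close>

lemma integrable_of_laplace_quotient_bounded:
  assumes B: "\<And>n. (1 - laplace_stieltjes F (u n)) / u n \<le> B"
  shows "integrable F (\<lambda>x. x)"
proof (rule integrable_of_bounded_integrals_tendsto[where h = "\<lambda>n x. (1 - exp (- u n * x)) / u n"])
  show "integrable F (\<lambda>x. (1 - exp (- u n * x)) / u n)" for n
    by (rule integral_exp_kernel1)
  show "AE x in F. (\<lambda>n. (1 - exp (- u n * x)) / u n) \<longlonglongrightarrow> x"
    by (intro AE_I2 filterlim_compose[OF tendsto_exp_kernel1 filterlim_at_right_0_seq[OF u_pos u_lim]])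
  show "AE x in F. 0 \<le> (1 - exp (- u n * x)) / u n" for n
    using nonneg_distributionD(7)[OF F]
    by eventually_elim (use u_pos[of n] in \<open>auto intro!: divide_nonneg_pos\<close>)
  show "(\<integral>x. (1 - exp (- u n * x)) / u n \<partial>F) \<le> B" for n
    unfolding integral_exp_kernel1(2) by (rule B)
qed auto

context
  assumes m: "integrable F (\<lambda>x. x)"
begin

lemma integral_exp_kernel2:
  "integrable F (\<lambda>x. (exp (- u n * x) - 1 + u n * x) / (u n)\<^sup>2)"
  "(\<integral>x. (exp (- u n * x) - 1 + u n * x) / (u n)\<^sup>2 \<partial>F)
     = (laplace_stieltjes F (u n) - 1 + mean F * u n) / (u n)\<^sup>2"
  using integrable_exp_nonneg_distribution[OF F, of "u n"] u_pos[of n] m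
  by (auto simp: laplace_stieltjes_eq[OF F] F.prob_space[simplified] mean_def)

lemma exp_kernel2_bounds:
  assumes "0 \<le> x"
  shows "0 \<le> (exp (- u n * x) - 1 + u n * x) / (u n)\<^sup>2"
    "(exp (- u n * x) - 1 + u n * x) / (u n)\<^sup>2 \<le> x\<^sup>2 / 2"
proof -
  show "0 \<le> (exp (- u n * x) - 1 + u n * x) / (u n)\<^sup>2"
    using exp_ge_add_one_self[of "- u n * x"] by (intro divide_nonneg_nonneg) auto
  have "exp (- u n * x) - 1 + u n * x \<le> x\<^sup>2 / 2 * (u n)\<^sup>2"
    using exp_minus_le_quadratic[of "u n * x"] assms u_pos[of n] by (simp add: power_mult_distrib mult.commute)
  then show "(exp (- u n * x) - 1 + u n * x) / (u n)\<^sup>2 \<le> x\<^sup>2 / 2"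
    using u_pos[of n] by (subst pos_divide_le_eq) auto
qed

text \<open>The same argument one order higher, with \<open>0 \<le> (exp (- u x) - 1 + u x) / u\<^sup>2 \<le> x\<^sup>2 / 2\<close>.\<close>

lemma laplace_quotient2_tendsto:
  assumes m2: "integrable F (\<lambda>x. x\<^sup>2)"
  shows "(\<lambda>n. (laplace_stieltjes F (u n) - 1 + mean F * u n) / (u n)\<^sup>2) \<longlonglongrightarrow> (\<integral>x. x\<^sup>2 \<partial>F) / 2"
proof -
  have "(\<lambda>n. \<integral>x. (exp (- u n * x) - 1 + u n * x) / (u n)\<^sup>2 \<partial>F) \<longlonglongrightarrow> (\<integral>x. x\<^sup>2 / 2 \<partial>F)"
  proof (rule integral_dominated_convergence[where w = "\<lambda>x. x\<^sup>2 / 2"])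
    show "AE x in F. (\<lambda>n. (exp (- u n * x) - 1 + u n * x) / (u n)\<^sup>2) \<longlonglongrightarrow> x\<^sup>2 / 2"
      by (intro AE_I2 filterlim_compose[OF tendsto_exp_kernel2 filterlim_at_right_0_seq[OF u_pos u_lim]])
    show "AE x in F. norm ((exp (- u n * x) - 1 + u n * x) / (u n)\<^sup>2) \<le> x\<^sup>2 / 2" for n
      using nonneg_distributionD(7)[OF F]
      by eventually_elim (simp only: real_norm_def abs_of_nonneg exp_kernel2_bounds)
  qed (use m2 in auto)
  then show ?thesis
    unfolding integral_exp_kernel2(2) by simp
qed

lemma integrable_square_of_laplace_quotient2_bounded:
  assumes B: "\<And>n. (laplace_stieltjes F (u n) - 1 + mean F * u n) / (u n)\<^sup>2 \<le> B"
  shows "integrable F (\<lambda>x. x\<^sup>2)"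
proof -
  have "integrable F (\<lambda>x. x\<^sup>2 / 2)"
  proof (rule integrable_of_bounded_integrals_tendsto[where h = "\<lambda>n x. (exp (- u n * x) - 1 + u n * x) / (u n)\<^sup>2"])
    show "integrable F (\<lambda>x. (exp (- u n * x) - 1 + u n * x) / (u n)\<^sup>2)" for n
      by (rule integral_exp_kernel2)
    show "AE x in F. (\<lambda>n. (exp (- u n * x) - 1 + u n * x) / (u n)\<^sup>2) \<longlonglongrightarrow> x\<^sup>2 / 2"
      by (intro AE_I2 filterlim_compose[OF tendsto_exp_kernel2 filterlim_at_right_0_seq[OF u_pos u_lim]])
    show "AE x in F. 0 \<le> (exp (- u n * x) - 1 + u n * x) / (u n)\<^sup>2" for n
      using nonneg_distributionD(7)[OF F] by eventually_elim (rule exp_kernel2_bounds)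
    show "(\<integral>x. (exp (- u n * x) - 1 + u n * x) / (u n)\<^sup>2 \<partial>F) \<le> B" for n
      unfolding integral_exp_kernel2(2) by (rule B)
  qed auto
  from integrable_mult_right[OF this, of 2] show ?thesis by simp
qed

end

end

lemma laplace_stieltjes_taylor_bounds:
  assumes F: "nonneg_distribution F" and m: "integrable F (\<lambda>x. x)" and s: "0 \<le> s"
  shows "0 \<le> laplace_stieltjes F s - 1 + mean F * s"
    and "integrable F (\<lambda>x. x\<^sup>2) \<Longrightarrow> laplace_stieltjes F s - 1 + mean F * s \<le> (\<integral>x. x\<^sup>2 \<partial>F) / 2 * s\<^sup>2"
proof -
  show "0 \<le> laplace_stieltjes F s - 1 + mean F * s"
    using one_minus_laplace_stieltjes_le[OF F m s] by simp
  interpret prob_space F using F by (rule nonneg_distributionD)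
  assume m2: "integrable F (\<lambda>x. x\<^sup>2)"
  have "laplace_stieltjes F s \<le> (\<integral>x. 1 - s * x + s\<^sup>2 / 2 * x\<^sup>2 \<partial>F)"
    unfolding laplace_stieltjes_eq[OF F]
  proof (rule integral_mono_AE)
    show "AE x in F. exp (- s * x) \<le> 1 - s * x + s\<^sup>2 / 2 * x\<^sup>2"
      using nonneg_distributionD(7)[OF F]
      by eventually_elim (use s exp_minus_le_quadratic[of "s * _"] in \<open>auto simp: power_mult_distrib\<close>)
  qed (use m m2 s integrable_exp_nonneg_distribution[OF F] in auto)
  also have "\<dots> = 1 - s * mean F + s\<^sup>2 / 2 * (\<integral>x. x\<^sup>2 \<partial>F)"
    using m m2 by (simp add: mean_def prob_space)
  finally show "laplace_stieltjes F s - 1 + mean F * s \<le> (\<integral>x. x\<^sup>2 \<partial>F) / 2 * s\<^sup>2"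
    by (simp add: mult_ac)
qed

text \<open>Equality \<open>E (exp (- s X)) = 1\<close> would force \<open>X = 0\<close> almost surely.\<close>

lemma laplace_stieltjes_less_1:
  assumes F: "nonneg_distribution F" and m: "0 < mean F" and s: "0 < s"
  shows "laplace_stieltjes F s < 1"
proof (rule ccontr)
  assume "\<not> ?thesis"
  then have e: "laplace_stieltjes F s = 1"
    using laplace_stieltjes_bounds[OF F, of s] s by simp
  interpret prob_space F using F by (rule nonneg_distributionD)
  have i: "integrable F (\<lambda>x. 1 - exp (- s * x))"
    using s by (intro Bochner_Integration.integrable_diff integrable_exp_nonneg_distribution[OF F]) auto
  have "(\<integral>x. 1 - exp (- s * x) \<partial>F) = 0"
    using s integrable_exp_nonneg_distribution[OF F, of s] e
    by (simp add: laplace_stieltjes_eq[OF F] prob_space)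
  moreover have "AE x in F. 0 \<le> 1 - exp (- s * x)"
    using nonneg_distributionD(7)[OF F] by eventually_elim (use s in auto)
  ultimately have "AE x in F. 1 - exp (- s * x) = 0"
    using integral_nonneg_eq_0_iff_AE[OF i] by simp
  then have "AE x in F. x = 0"
    by eventually_elim (use s in auto)
  then have "mean F = (\<integral>x. 0 \<partial>F)"
    unfolding mean_def by (intro integral_cong_AE) (auto intro!: nonneg_distribution_measurable[OF F])
  with m show False by simp
qed

section \<open>The function sigma\<close>

text \<open>The integrand of \<^const>\<open>sigma\<close>, as a function of the value \<open>t\<close> of \<open>T\<close>.\<close>

definition secant :: "real measure \<Rightarrow> real \<Rightarrow> real \<Rightarrow> real" where
  "secant F s t = (if t = 0 then mean F * s else (1 - laplace_stieltjes F (t * s)) / t)"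

lemma borel_measurable_secant:
  assumes "nonneg_distribution F"
  shows "secant F s \<in> borel_measurable borel"
proof -
  have [measurable]: "laplace_stieltjes F \<in> borel_measurable borel"
    by (rule borel_measurable_laplace_stieltjes[OF assms])
  show ?thesis unfolding secant_def[abs_def] by measurable
qed

lemma secant_bounds:
  assumes F: "nonneg_distribution F" "integrable F (\<lambda>x. x)" and "0 \<le> s" "0 \<le> t"
  shows "0 \<le> secant F s t" "secant F s t \<le> mean F * s"
proof -
  have "0 \<le> t * s" using assms by simp
  note l = laplace_stieltjes_bounds[OF F(1) this] one_minus_laplace_stieltjes_le[OF F this]
  show "0 \<le> secant F s t"
    using l mean_nonneg[OF F(1)] assms by (auto simp: secant_def intro!: divide_nonneg_nonneg)
  show "secant F s t \<le> mean F * s"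
    using l assms by (auto simp: secant_def field_simps)
qed

context
  fixes F FT :: "real measure"
  assumes F: "nonneg_distribution F" and m: "integrable F (\<lambda>x. x)" and FT: "nonneg_distribution FT"
begin

interpretation FT: prob_space FT using FT by (rule nonneg_distributionD)

lemma sigma_eq: "sigma FT F s = (\<integral>t. secant F s t \<partial>FT)"
  unfolding sigma_def secant_def[symmetric]
  by (rule set_integral_nonneg_distribution[OF FT borel_measurable_secant[OF F]])

lemma integrable_secant:
  assumes "0 \<le> s" shows "integrable FT (secant F s)"
  by (rule nonneg_distribution_integrable_bounded[OF FT borel_measurable_secant[OF F], where B = "mean F * s"])
    (use secant_bounds[OF F m assms] in auto)

lemma sigma_bounds:
  assumes "0 \<le> s" shows "0 \<le> sigma FT F s" "sigma FT F s \<le> mean F * s"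
proof -
  show "0 \<le> sigma FT F s"
    unfolding sigma_eq
    by (rule integral_nonneg_AE)
      (use nonneg_distributionD(7)[OF FT] secant_bounds(1)[OF F m assms] in auto)
  have "sigma FT F s \<le> (\<integral>t. mean F * s \<partial>FT)"
    unfolding sigma_eq
    by (rule integral_mono_AE[OF integrable_secant[OF assms]])
      (use nonneg_distributionD(7)[OF FT] secant_bounds(2)[OF F m assms] in auto)
  then show "sigma FT F s \<le> mean F * s" by (simp add: FT.prob_space)
qed

lemma sigma_pos:
  assumes "0 < s" "0 < mean F" shows "0 < sigma FT F s"
proof -
  have pos: "0 < secant F s t" if "0 \<le> t" for t
    using laplace_stieltjes_less_1[OF F assms(2), of "t * s"] that assms
    by (auto simp: secant_def intro!: divide_pos_pos)
  have "sigma FT F s \<noteq> 0"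
  proof
    assume "sigma FT F s = 0"
    moreover have "AE t in FT. 0 \<le> secant F s t"
      using nonneg_distributionD(7)[OF FT] by eventually_elim (use pos in \<open>auto intro: less_imp_le\<close>)
    ultimately have "AE t in FT. secant F s t = 0"
      using integral_nonneg_eq_0_iff_AE[OF integrable_secant] assms by (simp add: sigma_eq)
    then have "AE t in FT. False"
      using nonneg_distributionD(7)[OF FT] by eventually_elim (use pos in force)
    then show False by (simp add: FT.AE_False)
  qed
  then show ?thesis using sigma_bounds(1)[of s] assms by simp
qed

text \<open>As \<open>s\<close> tends to \<open>0\<close>, the integrand is asymptotic to \<open>mean F * s\<close> for every \<open>t \<ge> 0\<close>, and it is bounded by it.
So \<open>\<sigma>\<close> has the derivative \<open>mean F\<close> at \<open>0\<close> whatever the law of \<open>T\<close>.\<close>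

lemma sigma_quotient_tendsto:
  assumes u_pos: "\<And>n. 0 < u n" and u_lim: "u \<longlonglongrightarrow> 0"
  shows "(\<lambda>n. sigma FT F (u n) / u n) \<longlonglongrightarrow> mean F"
proof -
  have "(\<lambda>n. \<integral>t. secant F (u n) t / u n \<partial>FT) \<longlonglongrightarrow> (\<integral>t. mean F \<partial>FT)"
  proof (rule integral_dominated_convergence[where w = "\<lambda>t. mean F"])
    show "AE t in FT. (\<lambda>n. secant F (u n) t / u n) \<longlonglongrightarrow> mean F"
      using nonneg_distributionD(7)[OF FT]
    proof eventually_elim
      fix t :: real assume t: "0 \<le> t"
      show "(\<lambda>n. secant F (u n) t / u n) \<longlonglongrightarrow> mean F"
      proof (cases "t = 0")
        case True
        have "u n \<noteq> 0" for n using u_pos[of n] by simp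
        then show ?thesis by (simp add: secant_def True)
      next
        case False
        then have "(\<lambda>n. (1 - laplace_stieltjes F (t * u n)) / (t * u n)) \<longlonglongrightarrow> mean F"
          using t u_pos tendsto_mult_left[OF u_lim, of t]
          by (intro laplace_quotient_tendsto_mean[OF F _ _ m]) auto
        then show ?thesis using False by (simp add: secant_def)
      qed
    qed
    show "AE t in FT. norm (secant F (u n) t / u n) \<le> mean F" for n
      using nonneg_distributionD(7)[OF FT]
      by eventually_elim
        (use secant_bounds[OF F m, of "u n"] u_pos[of n] in \<open>auto simp: abs_of_nonneg pos_divide_le_eq less_imp_le\<close>)
    show "(\<lambda>t. secant F (u n) t / u n) \<in> borel_measurable FT" for n
      by (intro borel_measurable_divide nonneg_distribution_measurable[OF FT] borel_measurable_secant[OF F]) auto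
  qed auto
  then show ?thesis by (simp add: sigma_eq FT.prob_space)
qed

lemma mean_secant_defect:
  "mean F * s - secant F s t = (if t = 0 then 0 else (laplace_stieltjes F (t * s) - 1 + mean F * (t * s)) / t)"
  by (auto simp: secant_def field_simps)

lemma sigma_defect:
  assumes "0 \<le> s"
  shows "mean F * s - sigma FT F s = (\<integral>t. mean F * s - secant F s t \<partial>FT)"
  using integrable_secant[OF assms] by (simp add: sigma_eq FT.prob_space)

lemma secant_defect_bounds:
  assumes "0 \<le> s" "0 \<le> t" and K: "\<And>v. 0 \<le> v \<Longrightarrow> laplace_stieltjes F v - 1 + mean F * v \<le> K / 2 * v\<^sup>2"
  shows "0 \<le> mean F * s - secant F s t" "mean F * s - secant F s t \<le> t * (K / 2 * s\<^sup>2)"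
proof -
  show "0 \<le> mean F * s - secant F s t" using secant_bounds(2)[OF F m assms(1,2)] by simp
  have "(laplace_stieltjes F (t * s) - 1 + mean F * (t * s)) / t \<le> (K / 2 * (t * s)\<^sup>2) / t"
    using assms K[of "t * s"] by (intro divide_right_mono) auto
  then show "mean F * s - secant F s t \<le> t * (K / 2 * s\<^sup>2)"
    unfolding mean_secant_defect by (auto simp: power2_eq_square mult_ac)
qed

lemma sigma_defect_le:
  assumes s: "0 \<le> s" and K: "\<And>v. 0 \<le> v \<Longrightarrow> laplace_stieltjes F v - 1 + mean F * v \<le> K / 2 * v\<^sup>2"
    and t: "integrable FT (\<lambda>t. t)"
  shows "mean F * s - sigma FT F s \<le> mean FT * (K / 2 * s\<^sup>2)"
proof -
  have "mean F * s - sigma FT F s \<le> (\<integral>t. t * (K / 2 * s\<^sup>2) \<partial>FT)"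
    unfolding sigma_defect[OF s]
  proof (rule integral_mono_AE)
    show "AE t in FT. mean F * s - secant F s t \<le> t * (K / 2 * s\<^sup>2)"
      using nonneg_distributionD(7)[OF FT] by eventually_elim (rule secant_defect_bounds[OF s _ K])
  qed (use integrable_secant[OF s] t in auto)
  then show ?thesis by (simp add: mean_def)
qed

context
  fixes u :: "nat \<Rightarrow> real"
  assumes u_pos: "\<And>n. 0 < u n" and u_lim: "u \<longlonglongrightarrow> 0" and m2: "integrable F (\<lambda>x. x\<^sup>2)"
begin

text \<open>With \<open>v = t s\<close>, the defect \<open>mean F * s - secant F s t\<close> equals \<open>(\<phi> v - 1 + mean F * v) / t\<close>. Divided by
\<open>s\<^sup>2\<close> it is \<open>t\<close> times the second-order quotient of \<open>\<phi>\<close> at \<open>v\<close>. This factor \<open>t\<close> is where the mean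
of \<open>T\<close> enters.\<close>

lemma secant_defect_tendsto:
  assumes t: "0 \<le> t"
  shows "(\<lambda>n. (mean F * u n - secant F (u n) t) / (u n)\<^sup>2) \<longlonglongrightarrow> t * ((\<integral>x. x\<^sup>2 \<partial>F) / 2)"
proof (cases "t = 0")
  case True
  then show ?thesis by (simp add: secant_def)
next
  case False
  then have "(\<lambda>n. (laplace_stieltjes F (t * u n) - 1 + mean F * (t * u n)) / (t * u n)\<^sup>2) \<longlonglongrightarrow> (\<integral>x. x\<^sup>2 \<partial>F) / 2"
    using t u_pos tendsto_mult_left[OF u_lim, of t]
    by (intro laplace_quotient2_tendsto[OF F _ _ m m2]) auto
  from tendsto_mult_left[OF this, of t]
  have "(\<lambda>n. t * ((laplace_stieltjes F (t * u n) - 1 + mean F * (t * u n)) / (t * u n)\<^sup>2))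
      \<longlonglongrightarrow> t * ((\<integral>x. x\<^sup>2 \<partial>F) / 2)" .
  moreover have "t * (y / (t * v)\<^sup>2) = y / t / v\<^sup>2" for y v
    using False by (simp add: power2_eq_square)
  ultimately show ?thesis
    using False unfolding mean_secant_defect by simp
qed

lemma sigma_defect_tendsto:
  assumes t: "integrable FT (\<lambda>t. t)"
  shows "(\<lambda>n. (mean F * u n - sigma FT F (u n)) / (u n)\<^sup>2) \<longlonglongrightarrow> mean FT * ((\<integral>x. x\<^sup>2 \<partial>F) / 2)"
proof -
  have "(\<lambda>n. \<integral>t. (mean F * u n - secant F (u n) t) / (u n)\<^sup>2 \<partial>FT) \<longlonglongrightarrow> (\<integral>t. t * ((\<integral>x. x\<^sup>2 \<partial>F) / 2) \<partial>FT)"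
  proof (rule integral_dominated_convergence[where w = "\<lambda>t. t * ((\<integral>x. x\<^sup>2 \<partial>F) / 2)"])
    show "AE t in FT. (\<lambda>n. (mean F * u n - secant F (u n) t) / (u n)\<^sup>2) \<longlonglongrightarrow> t * ((\<integral>x. x\<^sup>2 \<partial>F) / 2)"
      using nonneg_distributionD(7)[OF FT] by eventually_elim (rule secant_defect_tendsto)
    show "AE t in FT. norm ((mean F * u n - secant F (u n) t) / (u n)\<^sup>2) \<le> t * ((\<integral>x. x\<^sup>2 \<partial>F) / 2)" for n
      using nonneg_distributionD(7)[OF FT]
    proof eventually_elim
      fix t :: real assume "0 \<le> t"
      from secant_defect_bounds[OF less_imp_le[OF u_pos] this laplace_stieltjes_taylor_bounds(2)[OF F m _ m2], of n]
      show "norm ((mean F * u n - secant F (u n) t) / (u n)\<^sup>2) \<le> t * ((\<integral>x. x\<^sup>2 \<partial>F) / 2)"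
        using u_pos[of n] by (simp add: abs_of_nonneg pos_divide_le_eq mult.assoc)
    qed
    show "(\<lambda>t. (mean F * u n - secant F (u n) t) / (u n)\<^sup>2) \<in> borel_measurable FT" for n
      by (intro borel_measurable_divide borel_measurable_diff nonneg_distribution_measurable[OF FT] borel_measurable_secant[OF F]) auto
    show "integrable FT (\<lambda>t. t * ((\<integral>x. x\<^sup>2 \<partial>F) / 2))" using t by (rule integrable_mult_left)
    show "(\<lambda>t. t * ((\<integral>x. x\<^sup>2 \<partial>F) / 2)) \<in> borel_measurable FT"
      by (rule nonneg_distribution_measurable[OF FT]) measurable
  qed
  moreover have "(\<integral>t. (mean F * u n - secant F (u n) t) / (u n)\<^sup>2 \<partial>FT) = (mean F * u n - sigma FT F (u n)) / (u n)\<^sup>2" for n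
    unfolding sigma_defect[OF less_imp_le[OF u_pos]] by (rule integral_divide_zero)
  moreover have "(\<integral>t. t * ((\<integral>x. x\<^sup>2 \<partial>F) / 2) \<partial>FT) = mean FT * ((\<integral>x. x\<^sup>2 \<partial>F) / 2)"
    unfolding mean_def by (rule integral_mult_left_zero)
  ultimately show ?thesis
    by (simp only:)
qed

lemma integrable_of_sigma_defect_bounded:
  assumes B: "\<And>n. (mean F * u n - sigma FT F (u n)) / (u n)\<^sup>2 \<le> B" and pos: "0 < (\<integral>x. x\<^sup>2 \<partial>F)"
  shows "integrable FT (\<lambda>t. t)"
proof -
  have "integrable FT (\<lambda>t. t * ((\<integral>x. x\<^sup>2 \<partial>F) / 2))"
  proof (rule integrable_of_bounded_integrals_tendsto)
    show "integrable FT (\<lambda>t. (mean F * u n - secant F (u n) t) / (u n)\<^sup>2)" for n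
      using integrable_secant[OF less_imp_le[OF u_pos], of n] by auto
    show "AE t in FT. 0 \<le> (mean F * u n - secant F (u n) t) / (u n)\<^sup>2" for n
      using nonneg_distributionD(7)[OF FT]
      by eventually_elim (use secant_bounds(2)[OF F m less_imp_le[OF u_pos]] in auto)
    show "AE t in FT. (\<lambda>n. (mean F * u n - secant F (u n) t) / (u n)\<^sup>2) \<longlonglongrightarrow> t * ((\<integral>x. x\<^sup>2 \<partial>F) / 2)"
      using nonneg_distributionD(7)[OF FT] by eventually_elim (rule secant_defect_tendsto)
    show "(\<integral>t. (mean F * u n - secant F (u n) t) / (u n)\<^sup>2 \<partial>FT) \<le> B" for n
      using B[of n] sigma_defect[OF less_imp_le[OF u_pos], of n] by simp
  qed (auto intro!: nonneg_distribution_measurable[OF FT])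
  from integrable_mult_left[OF this, of "2 / (\<integral>x. x\<^sup>2 \<partial>F)"] show ?thesis using pos by simp
qed

end

end

text \<open>At \<open>t > 0\<close> the integrands differ by \<open>\<bar>\<phi>\<^sub>F (t s) - \<phi>\<^sub>G (t s)\<bar> / t\<close>, which is at most \<open>t D s\<^sup>2\<close>. In the metric given
by the supremum of \<open>\<bar>\<phi>\<^sub>F v - \<phi>\<^sub>G v\<bar> / v\<^sup>2\<close>, passing to \<open>\<sigma>\<close> thus contracts by the factor \<open>E T\<close>.\<close>

lemma sigma_contraction:
  assumes F: "nonneg_distribution F" "integrable F (\<lambda>x. x)" and G: "nonneg_distribution G" "integrable G (\<lambda>x. x)"
    and eq: "mean F = mean G" and FT: "nonneg_distribution FT" "integrable FT (\<lambda>t. t)" and s: "0 \<le> s"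
    and D: "\<And>v. 0 \<le> v \<Longrightarrow> \<bar>laplace_stieltjes F v - laplace_stieltjes G v\<bar> \<le> D * v\<^sup>2"
  shows "\<bar>sigma FT F s - sigma FT G s\<bar> \<le> mean FT * D * s\<^sup>2"
proof -
  have "\<bar>sigma FT F s - sigma FT G s\<bar> = \<bar>\<integral>t. secant F s t - secant G s t \<partial>FT\<bar>"
    using integrable_secant[OF F FT(1) s] integrable_secant[OF G FT(1) s]
    by (simp add: sigma_eq[OF F FT(1)] sigma_eq[OF G FT(1)])
  also have "\<dots> \<le> (\<integral>t. \<bar>secant F s t - secant G s t\<bar> \<partial>FT)"
    by (rule integral_abs_bound)
  also have "\<dots> \<le> (\<integral>t. t * (D * s\<^sup>2) \<partial>FT)"
  proof (rule integral_mono_AE)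
    show "AE t in FT. \<bar>secant F s t - secant G s t\<bar> \<le> t * (D * s\<^sup>2)"
      using nonneg_distributionD(7)[OF FT(1)]
    proof eventually_elim
      fix t :: real assume t: "0 \<le> t"
      show "\<bar>secant F s t - secant G s t\<bar> \<le> t * (D * s\<^sup>2)"
      proof (cases "t = 0")
        case True then show ?thesis by (simp add: secant_def eq)
      next
        case False
        then have "\<bar>secant F s t - secant G s t\<bar> = \<bar>laplace_stieltjes F (t * s) - laplace_stieltjes G (t * s)\<bar> / t"
          using t by (simp add: secant_def abs_divide abs_minus_commute flip: diff_divide_distrib)
        also have "\<dots> \<le> D * (t * s)\<^sup>2 / t"
          using t s D[of "t * s"] by (intro divide_right_mono) auto
        finally show ?thesis using False by (simp add: power2_eq_square mult_ac)
      qed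
    qed
  qed (use integrable_secant[OF F FT(1) s] integrable_secant[OF G FT(1) s] FT in auto)
  finally show ?thesis by (simp add: mean_def mult_ac)
qed

section \<open>Laws whose transform is the right side of the equation\<close>

lemma nonneg_distribution_return: "0 \<le> c \<Longrightarrow> nonneg_distribution (return borel c)"
  by (intro nonneg_distributionI prob_space_return) (auto simp: AE_return)

lemma laplace_stieltjes_return: "0 \<le> c \<Longrightarrow> laplace_stieltjes (return borel c) s = exp (- s * c)"
  by (simp add: laplace_stieltjes_eq nonneg_distribution_return integral_return)

lemma laplace_stieltjes_abs:
  assumes F: "nonneg_distribution F"
  shows "(\<integral>x. exp (- s * \<bar>x\<bar>) \<partial>F) = laplace_stieltjes F s"
  unfolding laplace_stieltjes_eq[OF F]
proof (rule integral_cong_AE)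
  show "AE x in F. exp (- s * \<bar>x\<bar>) = exp (- s * x)"
    using nonneg_distributionD(7)[OF F] by eventually_elim simp
qed (auto intro!: nonneg_distribution_measurable[OF F])

text \<open>Fubini for a function of two independent variables. It serves for sums and for products.\<close>

lemma laplace_stieltjes_distr_pair:
  assumes P: "prob_space P" and F: "prob_space F"
    and h [measurable]: "h \<in> borel_measurable (P \<Otimes>\<^sub>M F)" and nn: "\<And>z. 0 \<le> h z"
  shows "nonneg_distribution (distr (P \<Otimes>\<^sub>M F) borel h)"
    and "0 \<le> s \<Longrightarrow> laplace_stieltjes (distr (P \<Otimes>\<^sub>M F) borel h) s = (\<integral>t. \<integral>x. exp (- s * h (t, x)) \<partial>F \<partial>P)"
proof -
  interpret P: prob_space P by fact
  interpret F: prob_space F by fact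
  interpret PF: pair_prob_space P F ..
  show nd: "nonneg_distribution (distr (P \<Otimes>\<^sub>M F) borel h)"
    by (rule nonneg_distribution_distr) (auto intro: PF.prob_space_axioms nn)
  assume s: "0 \<le> s"
  have int: "integrable (P \<Otimes>\<^sub>M F) (\<lambda>z. exp (- s * h z))"
    by (rule PF.integrable_const_bound[of _ 1]) (use s nn in auto)
  have "laplace_stieltjes (distr (P \<Otimes>\<^sub>M F) borel h) s = (\<integral>z. exp (- s * h z) \<partial>(P \<Otimes>\<^sub>M F))"
    unfolding laplace_stieltjes_eq[OF nd] by (rule integral_distr) auto
  also have "\<dots> = (\<integral>t. \<integral>x. exp (- s * h (t, x)) \<partial>F \<partial>P)"
    by (rule PF.integral_fst'[OF int, symmetric])
  finally show "laplace_stieltjes (distr (P \<Otimes>\<^sub>M F) borel h) s = (\<integral>t. \<integral>x. exp (- s * h (t, x)) \<partial>F \<partial>P)" .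
qed

lemma laplace_stieltjes_mult:
  assumes F: "nonneg_distribution F" and G: "nonneg_distribution G"
  obtains H where "nonneg_distribution H"
    "\<And>s. 0 \<le> s \<Longrightarrow> laplace_stieltjes H s = laplace_stieltjes F s * laplace_stieltjes G s"
proof -
  have [measurable_cong]: "sets F = sets borel" using F by (rule nonneg_distributionD)
  have [measurable_cong]: "sets G = sets borel" using G by (rule nonneg_distributionD)
  \<comment> \<open>The absolute values make \<open>?h\<close> nonnegative everywhere instead of almost everywhere.\<close>
  let ?h = "\<lambda>z::real \<times> real. \<bar>fst z\<bar> + \<bar>snd z\<bar>"
  have h: "?h \<in> borel_measurable (F \<Otimes>\<^sub>M G)" by measurable
  note * = laplace_stieltjes_distr_pair[OF nonneg_distributionD(2)[OF F] nonneg_distributionD(2)[OF G] h]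
  show ?thesis
  proof (rule that[OF *(1)])
    fix s :: real assume s: "0 \<le> s"
    have "laplace_stieltjes (distr (F \<Otimes>\<^sub>M G) borel ?h) s = (\<integral>t. \<integral>x. exp (- s * \<bar>t\<bar>) * exp (- s * \<bar>x\<bar>) \<partial>G \<partial>F)"
      using s by (subst *(2)) (auto simp: distrib_left exp_add[symmetric])
    also have "\<dots> = (\<integral>t. exp (- s * \<bar>t\<bar>) \<partial>F) * (\<integral>x. exp (- s * \<bar>x\<bar>) \<partial>G)"
      by simp
    also have "(\<integral>t. exp (- s * \<bar>t\<bar>) \<partial>F) = laplace_stieltjes F s"
      by (rule laplace_stieltjes_abs[OF F])
    also have "(\<integral>t. exp (- s * \<bar>t\<bar>) \<partial>G) = laplace_stieltjes G s"
      by (rule laplace_stieltjes_abs[OF G])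
    finally show "laplace_stieltjes (distr (F \<Otimes>\<^sub>M G) borel ?h) s = laplace_stieltjes F s * laplace_stieltjes G s" .
  qed auto
qed

lemma laplace_stieltjes_power:
  assumes F: "nonneg_distribution F"
  shows "\<exists>H. nonneg_distribution H \<and> (\<forall>s\<ge>0. laplace_stieltjes H s = laplace_stieltjes F s ^ n)"
proof (induction n)
  case 0
  show ?case
    by (rule exI[of _ "return borel 0"]) (simp add: nonneg_distribution_return laplace_stieltjes_return)
next
  case (Suc n)
  then obtain H where H: "nonneg_distribution H" "\<forall>s\<ge>0. laplace_stieltjes H s = laplace_stieltjes F s ^ n"
    by blast
  from laplace_stieltjes_mult[OF F H(1)] obtain H'
    where "nonneg_distribution H'" "\<And>s. 0 \<le> s \<Longrightarrow> laplace_stieltjes H' s = laplace_stieltjes F s * laplace_stieltjes H s"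
    by blast
  with H(2) show ?case by (intro exI[of _ H']) auto
qed

text \<open>Choose \<open>n\<close> with probability \<open>p n\<close>, then sample from \<open>K n\<close>.\<close>

lemma mixture_exists:
  assumes p: "\<And>n. 0 \<le> p n" "p sums 1" and K: "\<And>n::nat. nonneg_distribution (K n)"
  shows "\<exists>H. nonneg_distribution H \<and>
    (\<forall>f\<in>borel_measurable borel. (\<integral>\<^sup>+x. f x \<partial>H) = (\<Sum>n. ennreal (p n) * (\<integral>\<^sup>+x. f x \<partial>K n)))"
proof -
  define P where "P = density (count_space UNIV) (\<lambda>n::nat. ennreal (p n))"
  have sets_P: "sets P = sets (count_space UNIV)" by (simp add: P_def)
  have P_int: "(\<integral>\<^sup>+n. f n \<partial>P) = (\<Sum>n. ennreal (p n) * f n)" for f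
    by (simp add: P_def nn_integral_density nn_integral_count_space_nat)
  have P: "prob_space P"
  proof
    have "emeasure P (space P) = (\<integral>\<^sup>+n. 1 \<partial>P)" by simp
    also have "\<dots> = (\<Sum>n. ennreal (p n))" by (simp only: P_int) simp
    also have "\<dots> = 1" using suminf_ennreal_eq[OF p] by simp
    finally show "emeasure P (space P) = 1" .
  qed
  have K_meas: "K \<in> measurable P (subprob_algebra borel)"
  proof -
    have "K n \<in> space (subprob_algebra borel)" for n
      using nonneg_distributionD[OF K, of n]
      by (auto simp: space_subprob_algebra intro: prob_space_imp_subprob_space)
    then show ?thesis
      by (simp add: measurable_cong_sets[OF sets_P refl])
  qed
  have ne: "space P \<noteq> {}" using P by (rule prob_space.not_empty)
  have sets_H: "sets (P \<bind> K) = sets borel"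
    using nonneg_distributionD(5)[OF K] ne by (rule sets_bind)
  have H_int: "(\<integral>\<^sup>+x. f x \<partial>(P \<bind> K)) = (\<Sum>n. ennreal (p n) * (\<integral>\<^sup>+x. f x \<partial>K n))"
    if "f \<in> borel_measurable borel" for f
    by (subst nn_integral_bind[OF that K_meas]) (rule P_int)
  have H: "nonneg_distribution (P \<bind> K)"
  proof (rule nonneg_distributionI)
    show "prob_space (P \<bind> K)"
    proof
      have "emeasure (P \<bind> K) (space (P \<bind> K)) = (\<integral>\<^sup>+x. 1 \<partial>(P \<bind> K))" by simp
      also have "\<dots> = (\<Sum>n. ennreal (p n) * (\<integral>\<^sup>+x. 1 \<partial>K n))" by (rule H_int) simp
      also have "(\<lambda>n. \<integral>\<^sup>+x. 1 \<partial>K n) = (\<lambda>n. 1)"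
        using prob_space.emeasure_space_1[OF nonneg_distributionD(2)[OF K]] by simp
      also have "(\<Sum>n. ennreal (p n) * 1) = 1" using suminf_ennreal_eq[OF p] by simp
      finally show "emeasure (P \<bind> K) (space (P \<bind> K)) = 1" .
    qed
    show "sets (P \<bind> K) = sets borel" by fact
    have "(\<integral>\<^sup>+x. indicator {..<0} x \<partial>(P \<bind> K)) = (\<Sum>n. ennreal (p n) * (\<integral>\<^sup>+x. indicator {..<0} x \<partial>K n))"
      by (rule H_int) simp
    also have "(\<lambda>n. \<integral>\<^sup>+x. indicator {..<0::real} x \<partial>K n) = (\<lambda>n. 0)"
    proof
      fix n
      show "(\<integral>\<^sup>+x. indicator {..<0} x \<partial>K n) = 0"
        using nonneg_distributionD(7)[OF K, of n]
        by (subst nn_integral_0_iff_AE)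
          (auto intro!: nonneg_distribution_measurable[OF K] simp: not_less split: split_indicator)
    qed
    finally have "(\<integral>\<^sup>+x. indicator {..<0} x \<partial>(P \<bind> K)) = 0" by simp
    then have "AE x in P \<bind> K. indicator {..<0} x = (0::ennreal)"
      by (subst (asm) nn_integral_0_iff_AE) (auto simp: measurable_cong_sets[OF sets_H refl])
    then show "AE x in P \<bind> K. 0 \<le> x"
      by eventually_elim (auto split: split_indicator_asm)
  qed
  show ?thesis using H H_int by blast
qed

lemma laplace_stieltjes_mixture:
  assumes p: "\<And>n. 0 \<le> p n" and K: "\<And>n::nat. nonneg_distribution (K n)" and H: "nonneg_distribution H"
    and int: "\<forall>f\<in>borel_measurable borel. (\<integral>\<^sup>+x. f x \<partial>H) = (\<Sum>n. ennreal (p n) * (\<integral>\<^sup>+x. f x \<partial>K n))"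
    and s: "0 \<le> s"
  shows "(\<lambda>n. p n * laplace_stieltjes (K n) s) sums laplace_stieltjes H s"
proof -
  have nn: "0 \<le> p n * laplace_stieltjes (K n) s" for n
    using p laplace_stieltjes_bounds[OF K s] by simp
  have "ennreal (laplace_stieltjes H s) = (\<integral>\<^sup>+x. ennreal (exp (- s * x)) \<partial>H)"
    by (rule nn_integral_exp_nonneg_distribution[OF H s, symmetric])
  also have "\<dots> = (\<Sum>n. ennreal (p n) * (\<integral>\<^sup>+x. ennreal (exp (- s * x)) \<partial>K n))"
    by (rule int[rule_format]) measurable
  also have "\<dots> = (\<Sum>n. ennreal (p n * laplace_stieltjes (K n) s))"
    unfolding nn_integral_exp_nonneg_distribution[OF K s]
    by (simp add: ennreal_mult p laplace_stieltjes_bounds[OF K s])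
  finally have "(\<lambda>n. ennreal (p n * laplace_stieltjes (K n) s)) sums ennreal (laplace_stieltjes H s)"
    by (simp add: summable_sums)
  then show ?thesis
    using nn laplace_stieltjes_bounds[OF H s] by simp
qed

text \<open>Given \<open>y\<close>, the Poisson law with parameter \<open>r y\<close> has the generating function \<open>exp (- r y (1 - z))\<close>;
integrating over \<open>y\<close> with respect to \<open>G\<close> gives the transform of \<open>G\<close>. The interchange is monotone
convergence.\<close>

lemma sums_mixed_poisson:
  assumes G: "nonneg_distribution G" and r: "0 \<le> r" and z: "0 \<le> z" "z \<le> 1"
  shows "(\<lambda>n. (\<integral>y. exp (- r * y) * (r * y) ^ n / fact n \<partial>G) * z ^ n) sums laplace_stieltjes G (r * (1 - z))"
proof -
  \<comment> \<open>\<open>max 0 y\<close> makes the Poisson weights nonnegative for all \<open>y\<close>, not only where \<open>G\<close> lives.\<close>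
  define q where "q n y = exp (- r * y) * (r * max 0 y) ^ n / fact n" for n and y :: real
  have q_nn: "0 \<le> q n y" for n y using r by (auto simp: q_def)
  have q_sums: "(\<lambda>n. q n y * z ^ n) sums exp (- (r * (1 - z)) * y)" if "0 \<le> y" "0 \<le> z" for y z
  proof -
    have "(\<lambda>n. exp (- r * y) * ((r * y * z) ^ n /\<^sub>R fact n)) sums (exp (- r * y) * exp (r * y * z))"
      by (intro sums_mult exp_converges)
    also have "(\<lambda>n. exp (- r * y) * ((r * y * z) ^ n /\<^sub>R fact n)) = (\<lambda>n. q n y * z ^ n)"
      using that by (auto simp: q_def fun_eq_iff power_mult_distrib divide_inverse)
    also have "exp (- r * y) * exp (r * y * z) = exp (- (r * (1 - z)) * y)"
      by (simp add: algebra_simps flip: exp_add)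
    finally show ?thesis .
  qed
  have q_le: "q n y \<le> 1" if y: "0 \<le> y" for n y
  proof -
    have "(\<lambda>n. q n y) sums 1" using q_sums[OF y, of 1] by simp
    then show ?thesis
      using sum_le_suminf[of "\<lambda>n. q n y" "{n}"] q_nn by (auto simp: sums_iff)
  qed
  have q_meas [measurable]: "q n \<in> borel_measurable borel" for n
    unfolding q_def by measurable
  have q_int: "integrable G (q n)" for n
    by (rule nonneg_distribution_integrable_bounded[OF G, of _ 1]) (use q_nn q_le in auto)
  have q_eq: "(\<integral>y. exp (- r * y) * (r * y) ^ n / fact n \<partial>G) = (\<integral>y. q n y \<partial>G)" for n
  proof (rule integral_cong_AE)
    show "AE y in G. exp (- r * y) * (r * y) ^ n / fact n = q n y"
      using nonneg_distributionD(7)[OF G] by eventually_elim (simp add: q_def)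
  qed (auto intro!: nonneg_distribution_measurable[OF G])
  have "ennreal (laplace_stieltjes G (r * (1 - z))) = (\<integral>\<^sup>+y. ennreal (exp (- (r * (1 - z)) * y)) \<partial>G)"
    using r z by (intro nn_integral_exp_nonneg_distribution[OF G, symmetric]) auto
  also have "\<dots> = (\<integral>\<^sup>+y. (\<Sum>n. ennreal (q n y * z ^ n)) \<partial>G)"
  proof (rule nn_integral_cong_AE)
    show "AE y in G. ennreal (exp (- (r * (1 - z)) * y)) = (\<Sum>n. ennreal (q n y * z ^ n))"
      using nonneg_distributionD(7)[OF G]
      by eventually_elim (rule suminf_ennreal_eq[symmetric], use q_nn z q_sums in auto)
  qed
  also have "\<dots> = (\<Sum>n. \<integral>\<^sup>+y. ennreal (q n y * z ^ n) \<partial>G)"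
    by (rule nn_integral_suminf) (auto intro!: nonneg_distribution_measurable[OF G])
  also have "(\<lambda>n. \<integral>\<^sup>+y. ennreal (q n y * z ^ n) \<partial>G) = (\<lambda>n. ennreal ((\<integral>y. q n y \<partial>G) * z ^ n))"
  proof
    fix n
    have "(\<integral>\<^sup>+y. ennreal (q n y * z ^ n) \<partial>G) = ennreal (\<integral>y. q n y * z ^ n \<partial>G)"
      by (rule nn_integral_eq_integral) (use q_int q_nn z in auto)
    then show "(\<integral>\<^sup>+y. ennreal (q n y * z ^ n) \<partial>G) = ennreal ((\<integral>y. q n y \<partial>G) * z ^ n)" by simp
  qed
  finally have "(\<lambda>n. ennreal ((\<integral>y. q n y \<partial>G) * z ^ n)) sums ennreal (laplace_stieltjes G (r * (1 - z)))"
    by (simp add: summable_sums)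
  moreover have "0 \<le> laplace_stieltjes G (r * (1 - z))"
    using r z by (intro laplace_stieltjes_bounds[OF G]) auto
  ultimately show ?thesis
    unfolding q_eq using q_nn z by simp
qed

text \<open>\<open>H\<close> is the law of a sum of \<open>n\<close> independent variables of law \<open>J\<close>, where \<open>n\<close> is Poisson with the random
parameter \<open>r Y\<close> and \<open>Y\<close> has law \<open>G\<close>.\<close>

lemma mixed_compound_poisson_exists:
  assumes G: "nonneg_distribution G" and J: "nonneg_distribution J" and r: "0 \<le> r"
  obtains H where "nonneg_distribution H"
    "\<And>s. 0 \<le> s \<Longrightarrow> laplace_stieltjes H s = laplace_stieltjes G (r * (1 - laplace_stieltjes J s))"
proof -
  define p where "p n = (\<integral>y. exp (- r * y) * (r * y) ^ n / fact n \<partial>G)" for n :: nat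
  have p_nn: "0 \<le> p n" for n
    unfolding p_def
  proof (rule integral_nonneg_AE)
    show "AE y in G. 0 \<le> exp (- r * y) * (r * y) ^ n / fact n"
      using nonneg_distributionD(7)[OF G] by eventually_elim (simp add: r)
  qed
  have p_sums: "p sums 1"
  proof -
    have "(\<lambda>n. p n * 1 ^ n) sums laplace_stieltjes G (r * (1 - 1))"
      unfolding p_def by (rule sums_mixed_poisson[OF G r]) auto
    then show ?thesis by (simp add: laplace_stieltjes_0[OF G])
  qed
  define K where "K n = (SOME H. nonneg_distribution H \<and>
      (\<forall>s\<ge>0. laplace_stieltjes H s = laplace_stieltjes J s ^ n))" for n
  have K': "nonneg_distribution (K n) \<and> (\<forall>s\<ge>0. laplace_stieltjes (K n) s = laplace_stieltjes J s ^ n)" for n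
    unfolding K_def by (rule someI_ex[OF laplace_stieltjes_power[OF J]])
  then have K: "nonneg_distribution (K n)" "0 \<le> s \<Longrightarrow> laplace_stieltjes (K n) s = laplace_stieltjes J s ^ n" for n s
    by auto
  obtain H where H: "nonneg_distribution H"
    "\<forall>f\<in>borel_measurable borel. (\<integral>\<^sup>+x. f x \<partial>H) = (\<Sum>n. ennreal (p n) * (\<integral>\<^sup>+x. f x \<partial>K n))"
    using mixture_exists[of p K, OF p_nn p_sums K(1)] by blast
  show ?thesis
  proof (rule that[OF H(1)])
    fix s :: real assume s: "0 \<le> s"
    have "(\<lambda>n. p n * laplace_stieltjes (K n) s) sums laplace_stieltjes H s"
      using p_nn K(1) H s by (rule laplace_stieltjes_mixture)
    then have "(\<lambda>n. p n * laplace_stieltjes J s ^ n) sums laplace_stieltjes H s"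
      by (simp only: K(2)[OF s])
    moreover have "(\<lambda>n. p n * laplace_stieltjes J s ^ n) sums laplace_stieltjes G (r * (1 - laplace_stieltjes J s))"
      unfolding p_def by (rule sums_mixed_poisson[OF G r laplace_stieltjes_bounds[OF J s]])
    ultimately show "laplace_stieltjes H s = laplace_stieltjes G (r * (1 - laplace_stieltjes J s))"
      by (rule sums_unique2)
  qed
qed

text \<open>When \<open>T\<close> is bounded away from \<open>0\<close>, the jump measure \<open>E (1 / T; T X \<in> dx)\<close> behind \<open>\<sigma>\<close> is finite. Its mass
is \<open>r\<close>, and \<open>J\<close> is its normalisation: the law of \<open>T X\<close> after \<open>T\<close> has been reweighted by \<open>1 / (r T)\<close>.\<close>

lemma truncated_sigma_is_exponent:
  assumes F: "nonneg_distribution F" and FT: "nonneg_distribution FT" and e: "0 < \<epsilon>"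
  obtains r J where "0 \<le> r" "nonneg_distribution J"
    "\<And>s. 0 \<le> s \<Longrightarrow> (\<integral>t. secant F s (max t \<epsilon>) \<partial>FT) = r * (1 - laplace_stieltjes J s)"
proof -
  have [measurable_cong]: "sets F = sets borel" using F by (rule nonneg_distributionD)
  have [measurable_cong]: "sets FT = sets borel" using FT by (rule nonneg_distributionD)
  have [measurable]: "laplace_stieltjes F \<in> borel_measurable borel"
    by (rule borel_measurable_laplace_stieltjes[OF F])
  interpret FT: prob_space FT using FT by (rule nonneg_distributionD)
  have tau: "0 < max t \<epsilon>" for t using e by simp
  have int: "integrable FT (\<lambda>t. 1 / max t \<epsilon>)"
    by (rule FT.integrable_const_bound[of _ "1 / \<epsilon>"]) (use e tau in \<open>auto simp: frac_le\<close>)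
  define r where "r = (\<integral>t. 1 / max t \<epsilon> \<partial>FT)"
  have "0 \<le> r" unfolding r_def using tau by (intro Bochner_Integration.integral_nonneg) (simp add: less_imp_le)
  moreover have "r \<noteq> 0"
  proof
    assume "r = 0"
    then have "AE t in FT. 1 / max t \<epsilon> = 0"
      unfolding r_def using tau by (subst (asm) integral_nonneg_eq_0_iff_AE[OF int]) (auto simp: less_imp_le)
    moreover have "1 / max t \<epsilon> \<noteq> 0" for t using tau[of t] by simp
    ultimately have "AE t in FT. False" by simp
    then show False by (simp add: FT.AE_False)
  qed
  ultimately have r: "0 < r" by simp
  define P where "P = density FT (\<lambda>t. ennreal (1 / (r * max t \<epsilon>)))"
  have [measurable_cong]: "sets P = sets borel" by (simp add: P_def nonneg_distributionD(5)[OF FT])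
  have w_nn: "0 \<le> 1 / (r * max t \<epsilon>)" for t using r tau[of t] by simp
  have P_int: "(\<integral>t. f t \<partial>P) = (\<integral>t. 1 / (r * max t \<epsilon>) * f t \<partial>FT)" if [measurable]: "f \<in> borel_measurable borel" for f :: "real \<Rightarrow> real"
    unfolding P_def by (subst integral_density) (use w_nn in auto)
  have P: "prob_space P"
  proof
    have "emeasure P (space P) = (\<integral>\<^sup>+t. ennreal (1 / (r * max t \<epsilon>)) \<partial>FT)"
      unfolding P_def by (subst emeasure_density) (auto intro!: nn_integral_cong)
    also have "\<dots> = ennreal (\<integral>t. 1 / r * (1 / max t \<epsilon>) \<partial>FT)"
      using integrable_mult_right[OF int, of "1 / r"] w_nn by (subst nn_integral_eq_integral) auto
    also have "(\<integral>t. 1 / r * (1 / max t \<epsilon>) \<partial>FT) = 1"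
      using r by (subst integral_mult_right_zero) (simp add: r_def[symmetric])
    finally show "emeasure P (space P) = 1" by simp
  qed
  let ?h = "\<lambda>z::real \<times> real. max (fst z) \<epsilon> * \<bar>snd z\<bar>"
  have h: "?h \<in> borel_measurable (P \<Otimes>\<^sub>M F)" by measurable
  have h_nn: "0 \<le> ?h z" for z using e by simp
  note J = laplace_stieltjes_distr_pair[OF P nonneg_distributionD(2)[OF F] h h_nn]
  show ?thesis
  proof (rule that[OF less_imp_le[OF r] J(1)])
    fix s :: real assume s: "0 \<le> s"
    have "laplace_stieltjes (distr (P \<Otimes>\<^sub>M F) borel ?h) s = (\<integral>t. laplace_stieltjes F (max t \<epsilon> * s) \<partial>P)"
    proof (subst J(2)[OF s], rule Bochner_Integration.integral_cong[OF refl])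
      fix t
      show "(\<integral>x. exp (- s * ?h (t, x)) \<partial>F) = laplace_stieltjes F (max t \<epsilon> * s)"
        using laplace_stieltjes_abs[OF F, of "max t \<epsilon> * s"] by (simp add: mult_ac)
    qed
    also have "\<dots> = (\<integral>t. 1 / (r * max t \<epsilon>) * laplace_stieltjes F (max t \<epsilon> * s) \<partial>FT)"
      by (rule P_int) measurable
    also have "\<dots> = (\<integral>t. 1 / r * (laplace_stieltjes F (max t \<epsilon> * s) / max t \<epsilon>) \<partial>FT)"
      by simp
    also have "\<dots> = 1 / r * (\<integral>t. laplace_stieltjes F (max t \<epsilon> * s) / max t \<epsilon> \<partial>FT)"
      by (rule integral_mult_right_zero)
    finally have J_eq: "r * laplace_stieltjes (distr (P \<Otimes>\<^sub>M F) borel ?h) s = (\<integral>t. laplace_stieltjes F (max t \<epsilon> * s) / max t \<epsilon> \<partial>FT)"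
      using r by simp
    have int2: "integrable FT (\<lambda>t. laplace_stieltjes F (max t \<epsilon> * s) / max t \<epsilon>)"
    proof (rule FT.integrable_const_bound[of _ "1 / \<epsilon>"])
      show "AE t in FT. norm (laplace_stieltjes F (max t \<epsilon> * s) / max t \<epsilon>) \<le> 1 / \<epsilon>"
      proof (rule AE_I2)
        fix t
        have "0 \<le> max t \<epsilon> * s" using tau[of t] s by simp
        from laplace_stieltjes_bounds[OF F this]
        show "norm (laplace_stieltjes F (max t \<epsilon> * s) / max t \<epsilon>) \<le> 1 / \<epsilon>"
          using tau[of t] e by (simp add: frac_le)
      qed
    qed measurable
    have "(\<integral>t. secant F s (max t \<epsilon>) \<partial>FT) = (\<integral>t. 1 / max t \<epsilon> - laplace_stieltjes F (max t \<epsilon> * s) / max t \<epsilon> \<partial>FT)"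
    proof (rule Bochner_Integration.integral_cong[OF refl])
      fix t show "secant F s (max t \<epsilon>) = 1 / max t \<epsilon> - laplace_stieltjes F (max t \<epsilon> * s) / max t \<epsilon>"
        unfolding secant_def using tau[of t] by (simp only: diff_divide_distrib) simp
    qed
    also have "\<dots> = r - r * laplace_stieltjes (distr (P \<Otimes>\<^sub>M F) borel ?h) s"
      unfolding J_eq unfolding r_def by (rule Bochner_Integration.integral_diff[OF int int2])
    finally show "(\<integral>t. secant F s (max t \<epsilon>) \<partial>FT) = r * (1 - laplace_stieltjes (distr (P \<Otimes>\<^sub>M F) borel ?h) s)"
      by (simp add: right_diff_distrib)
  qed
qed

lemma laplace_stieltjes_tendsto:
  assumes G: "nonneg_distribution G" "integrable G (\<lambda>x. x)"
    and x: "\<And>n. 0 \<le> x n" and lim: "x \<longlonglongrightarrow> y"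
  shows "(\<lambda>n. laplace_stieltjes G (x n)) \<longlonglongrightarrow> laplace_stieltjes G y"
proof (rule LIM_zero_cancel, rule Lim_null_comparison)
  have y: "0 \<le> y" by (rule LIMSEQ_le_const[OF lim]) (use x in auto)
  show "\<forall>\<^sub>F n in sequentially. norm (laplace_stieltjes G (x n) - laplace_stieltjes G y) \<le> mean G * \<bar>x n - y\<bar>"
    using laplace_stieltjes_Lipschitz[OF G x y] by simp
  show "(\<lambda>n. mean G * \<bar>x n - y\<bar>) \<longlonglongrightarrow> 0"
    using tendsto_mult_right_zero[OF tendsto_rabs_zero[OF LIM_zero[OF lim]]] .
qed

text \<open>The right side of the equation is a Laplace--Stieltjes transform for every \<open>F\<close> with a finite mean. With \<open>T\<close> replaced by
\<open>max T \<epsilon>\<close> this is the mixed compound Poisson law. In general the jump measure of \<open>\<sigma>\<close> may be infinite, and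
\<open>T = 0\<close> contributes a drift; both are recovered by letting \<open>\<epsilon>\<close> tend to \<open>0\<close>.\<close>

theorem equation_operator_exists:
  assumes F: "nonneg_distribution F" "integrable F (\<lambda>x. x)" and G: "nonneg_distribution G" "integrable G (\<lambda>x. x)"
    and FT: "nonneg_distribution FT"
  obtains H where "nonneg_distribution H"
    "\<And>s. 0 \<le> s \<Longrightarrow> laplace_stieltjes H s = laplace_stieltjes G (sigma FT F s)"
proof -
  interpret FT: prob_space FT using FT by (rule nonneg_distributionD)
  define u :: "nat \<Rightarrow> real" where "u n = 1 / (real n + 1)" for n
  have u_pos: "0 < u n" for n by (simp add: u_def)
  have u_lim: "u \<longlonglongrightarrow> 0" unfolding u_def by real_asymp
  define \<sigma> where "\<sigma> n s = (\<integral>t. secant F s (max t (u n)) \<partial>FT)" for n s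
  have "\<exists>H. nonneg_distribution H \<and> (\<forall>s\<ge>0. laplace_stieltjes H s = laplace_stieltjes G (\<sigma> n s))" for n
  proof -
    obtain r J where r: "0 \<le> r" and J: "nonneg_distribution J"
      and eq: "\<And>s. 0 \<le> s \<Longrightarrow> \<sigma> n s = r * (1 - laplace_stieltjes J s)"
      using truncated_sigma_is_exponent[OF F(1) FT u_pos[of n]] unfolding \<sigma>_def by blast
    obtain H where "nonneg_distribution H"
      "\<And>s. 0 \<le> s \<Longrightarrow> laplace_stieltjes H s = laplace_stieltjes G (r * (1 - laplace_stieltjes J s))"
      using mixed_compound_poisson_exists[OF G(1) J r] by blast
    then show ?thesis
      by (intro exI[of _ H]) (simp add: eq)
  qed
  then have "\<forall>n. \<exists>H. nonneg_distribution H \<and> (\<forall>s\<ge>0. laplace_stieltjes H s = laplace_stieltjes G (\<sigma> n s))"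
    by blast
  from choice[OF this] obtain H where "\<forall>n. nonneg_distribution (H n) \<and>
      (\<forall>s\<ge>0. laplace_stieltjes (H n) s = laplace_stieltjes G (\<sigma> n s))"
    by blast
  then have H: "nonneg_distribution (H n)" "0 \<le> s \<Longrightarrow> laplace_stieltjes (H n) s = laplace_stieltjes G (\<sigma> n s)" for n s
    by auto
  have max_nn: "0 \<le> max t (u n)" for t n using u_pos[of n] by simp
  have sec_meas: "(\<lambda>t. secant F s (max t (u n))) \<in> borel_measurable FT" for s n
    by (rule nonneg_distribution_measurable[OF FT], rule measurable_compose[OF _ borel_measurable_secant[OF F(1)]]) measurable
  have sec_int: "integrable FT (\<lambda>t. secant F s (max t (u n)))" if s: "0 \<le> s" for s n
    by (rule FT.integrable_const_bound[of _ "mean F * s"])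
      (use secant_bounds[OF F s max_nn] sec_meas in auto)
  have \<sigma>_nn: "0 \<le> \<sigma> n s" if "0 \<le> s" for n s
    unfolding \<sigma>_def using secant_bounds(1)[OF F that max_nn] by (rule Bochner_Integration.integral_nonneg)
  have \<sigma>_le: "\<sigma> n s \<le> mean F * s" if s: "0 \<le> s" for n s
  proof -
    have "\<sigma> n s \<le> (\<integral>t. mean F * s \<partial>FT)"
      unfolding \<sigma>_def using secant_bounds(2)[OF F s max_nn] by (intro integral_mono sec_int[OF s]) auto
    then show ?thesis by (simp add: FT.prob_space)
  qed
  have \<sigma>_lim: "(\<lambda>n. \<sigma> n s) \<longlonglongrightarrow> sigma FT F s" if s: "0 \<le> s" for s
    unfolding \<sigma>_def sigma_eq[OF F FT]
  proof (rule integral_dominated_convergence[where w = "\<lambda>_. mean F * s"])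
    show "AE t in FT. norm (secant F s (max t (u n))) \<le> mean F * s" for n
      using secant_bounds[OF F s max_nn] by auto
    show "AE t in FT. (\<lambda>n. secant F s (max t (u n))) \<longlonglongrightarrow> secant F s t"
      using nonneg_distributionD(7)[OF FT]
    proof eventually_elim
      fix t :: real assume t: "0 \<le> t"
      show "(\<lambda>n. secant F s (max t (u n))) \<longlonglongrightarrow> secant F s t"
      proof (cases "t = 0 \<and> 0 < s")
        case True
        have "(\<lambda>n. s * ((1 - laplace_stieltjes F (u n * s)) / (u n * s))) \<longlonglongrightarrow> s * mean F"
          using True u_pos tendsto_mult_right[OF u_lim, of s]
          by (intro tendsto_mult_left laplace_quotient_tendsto_mean[OF F(1) _ _ F(2)]) auto
        moreover have "secant F s (max t (u n)) = s * ((1 - laplace_stieltjes F (u n * s)) / (u n * s))" for n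
          using True u_pos[of n] by (simp add: secant_def)
        ultimately show ?thesis
          using True by (simp add: secant_def mult.commute)
      next
        case False
        have "\<forall>\<^sub>F n in sequentially. secant F s (max t (u n)) = secant F s t"
        proof (cases "s = 0")
          case True
          then show ?thesis by (simp add: secant_def laplace_stieltjes_0[OF F(1)])
        next
          case s0: False
          then have "0 < t" using False s t by auto
          then have "\<forall>\<^sub>F n in sequentially. u n < t" using u_lim by (simp add: order_tendstoD)
          then show ?thesis by eventually_elim simp
        qed
        then show ?thesis by (rule tendsto_eventually)
      qed
    qed
  qed (use sec_meas nonneg_distribution_measurable[OF FT borel_measurable_secant[OF F(1)]] in auto)
  have lim: "(\<lambda>n. laplace_stieltjes (H n) s) \<longlonglongrightarrow> laplace_stieltjes G (sigma FT F s)" if s: "0 \<le> s" for s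
    unfolding H(2)[OF s] by (rule laplace_stieltjes_tendsto[OF G \<sigma>_nn[OF s] \<sigma>_lim[OF s]])
  have tight: "1 - laplace_stieltjes (H n) s \<le> mean G * mean F * s" if s: "0 \<le> s" for n s
    using one_minus_laplace_stieltjes_le[OF G \<sigma>_nn[OF s], of n]
      mult_left_mono[OF \<sigma>_le[OF s, of n] mean_nonneg[OF G(1)]] by (simp add: H(2)[OF s] mult.assoc)
  show ?thesis
    using laplace_stieltjes_continuity[OF H(1) lim tight] that by blast
qed

section \<open>The equation with a general mixing law\<close>

lemma second_moment_ge:
  assumes F: "nonneg_distribution F" and m: "integrable F (\<lambda>x. x)" and m2: "integrable F (\<lambda>x. x\<^sup>2)"
  shows "(mean F)\<^sup>2 \<le> (\<integral>x. x\<^sup>2 \<partial>F)"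
proof -
  interpret prob_space F using F by (rule nonneg_distributionD)
  show ?thesis
    using variance_eq[OF m m2] variance_positive[of "\<lambda>x. x"] by (simp add: mean_def)
qed

text \<open>Jensen's inequality, by the tangent of \<open>exp (- s x)\<close> at the mean. Among all laws with a given mean the point
mass thus has the smallest transform.\<close>

lemma exp_mean_le_laplace_stieltjes:
  assumes F: "nonneg_distribution F" and m: "integrable F (\<lambda>x. x)" and s: "0 \<le> s"
  shows "exp (- s * mean F) \<le> laplace_stieltjes F s"
proof -
  interpret prob_space F using F by (rule nonneg_distributionD)
  let ?c = "exp (- s * mean F)"
  have "(\<integral>x. ?c * (1 - s * (x - mean F)) \<partial>F) \<le> (\<integral>x. exp (- s * x) \<partial>F)"
  proof (rule integral_mono)
    fix x
    have "?c * (1 - s * (x - mean F)) \<le> ?c * exp (- s * (x - mean F))"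
      using exp_ge_add_one_self[of "- s * (x - mean F)"] by (intro mult_left_mono) auto
    also have "\<dots> = exp (- s * x)" by (simp add: algebra_simps flip: exp_add)
    finally show "?c * (1 - s * (x - mean F)) \<le> exp (- s * x)" .
  qed (use m integrable_exp_nonneg_distribution[OF F s] in auto)
  also have "(\<integral>x. ?c * (1 - s * (x - mean F)) \<partial>F) = ?c"
    using m by (simp add: mean_def[symmetric] prob_space)
  finally show ?thesis by (simp add: laplace_stieltjes_eq[OF F])
qed

lemma sigma_antimono:
  assumes F: "nonneg_distribution F" "integrable F (\<lambda>x. x)" and G: "nonneg_distribution G" "integrable G (\<lambda>x. x)"
    and eq: "mean F = mean G" and FT: "nonneg_distribution FT" and s: "0 \<le> s"
    and le: "\<And>v. 0 \<le> v \<Longrightarrow> laplace_stieltjes F v \<le> laplace_stieltjes G v"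
  shows "sigma FT G s \<le> sigma FT F s"
  unfolding sigma_eq[OF F FT] sigma_eq[OF G FT]
proof (rule integral_mono_AE[OF integrable_secant[OF G FT s] integrable_secant[OF F FT s]])
  show "AE t in FT. secant G s t \<le> secant F s t"
    using nonneg_distributionD(7)[OF FT]
  proof eventually_elim
    fix t :: real assume t: "0 \<le> t"
    show "secant G s t \<le> secant F s t"
      using t s le[of "t * s"] eq by (auto simp: secant_def intro!: divide_right_mono)
  qed
qed

lemma sigma_tendsto:
  assumes F: "\<And>n. nonneg_distribution (F n)" "\<And>n. integrable (F n) (\<lambda>x. x)" "\<And>n. mean (F n) = \<mu>"
    and H: "nonneg_distribution H" "integrable H (\<lambda>x. x)" "mean H = \<mu>"
    and FT: "nonneg_distribution FT" and s: "0 \<le> s"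
    and lim: "\<And>v. 0 \<le> v \<Longrightarrow> (\<lambda>n. laplace_stieltjes (F n) v) \<longlonglongrightarrow> laplace_stieltjes H v"
  shows "(\<lambda>n. sigma FT (F n) s) \<longlonglongrightarrow> sigma FT H s"
proof -
  interpret prob_space FT using FT by (rule nonneg_distributionD)
  have "(\<lambda>n. \<integral>t. secant (F n) s t \<partial>FT) \<longlonglongrightarrow> (\<integral>t. secant H s t \<partial>FT)"
  proof (rule integral_dominated_convergence[where w = "\<lambda>t. \<mu> * s"])
    show "AE t in FT. norm (secant (F n) s t) \<le> \<mu> * s" for n
      using nonneg_distributionD(7)[OF FT]
    proof eventually_elim
      fix t :: real assume t: "0 \<le> t"
      show "norm (secant (F n) s t) \<le> \<mu> * s"
        using secant_bounds[OF F(1) F(2) s t, of n] F(3)[of n] by simp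
    qed
    show "AE t in FT. (\<lambda>n. secant (F n) s t) \<longlonglongrightarrow> secant H s t"
      using nonneg_distributionD(7)[OF FT]
    proof eventually_elim
      fix t :: real assume t: "0 \<le> t"
      show "(\<lambda>n. secant (F n) s t) \<longlonglongrightarrow> secant H s t"
      proof (cases "t = 0")
        case True then show ?thesis by (simp add: secant_def F(3) H(3))
      next
        case False
        have "0 \<le> t * s" using t s by simp
        then have "(\<lambda>n. (1 - laplace_stieltjes (F n) (t * s)) / t) \<longlonglongrightarrow> (1 - laplace_stieltjes H (t * s)) / t"
          using False by (intro tendsto_intros lim)
        then show ?thesis using False by (simp add: secant_def)
      qed
    qed
    show "secant (F n) s \<in> borel_measurable FT" for n
      by (rule nonneg_distribution_measurable[OF FT borel_measurable_secant[OF F(1)]])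
    show "secant H s \<in> borel_measurable FT"
      by (rule nonneg_distribution_measurable[OF FT borel_measurable_secant[OF H(1)]])
    show "integrable FT (\<lambda>t. \<mu> * s)" by simp
  qed
  moreover have "sigma FT (F n) s = (\<integral>t. secant (F n) s t \<partial>FT)" for n
    by (rule sigma_eq[OF F(1) F(2) FT])
  moreover have "sigma FT H s = (\<integral>t. secant H s t \<partial>FT)"
    by (rule sigma_eq[OF H(1) H(2) FT])
  ultimately show ?thesis by (simp only:)
qed

text \<open>The equation with an arbitrary law \<open>G\<close> in place of the one built from \<open>\<zeta>\<close> and \<open>\<Lambda>\<close>.\<close>

definition fixed_law :: "real \<Rightarrow> real measure \<Rightarrow> real measure \<Rightarrow> real measure \<Rightarrow> bool" where
  "fixed_law \<mu> FT G F \<longleftrightarrow>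
    nonneg_distribution F \<and> integrable F (\<lambda>x. x) \<and> mean F = \<mu> \<and> integrable F (\<lambda>x. x\<^sup>2) \<and>
    (\<forall>s\<ge>0. laplace_stieltjes F s = laplace_stieltjes G (sigma FT F s))"

context
  fixes \<mu> :: real and FT G :: "real measure"
  assumes \<mu>: "0 < \<mu>" and FT: "nonneg_distribution FT" and G: "nonneg_distribution G"
begin

text \<open>Let \<open>\<gamma>\<close> be the transform of \<open>G\<close>, and compare the expansions of \<open>\<phi> = \<gamma> \<circ> \<sigma>\<close> at \<open>0\<close>. To first order, \<open>\<mu> = mean G * \<mu>\<close>. To second order,
\<open>\<phi> s - 1 + \<mu> s = (\<gamma> (\<sigma> s) - 1 + \<sigma> s) + (\<mu> s - \<sigma> s)\<close>,
and both summands are nonnegative, so both quotients by \<open>s\<^sup>2\<close> stay bounded. Hence \<open>G\<close> has a finite second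
moment, \<open>T\<close> has a finite mean, and the limits give the last equation. As its first summand is positive and
\<open>E X\<^sup>2 \<ge> \<mu>\<^sup>2 > 0\<close>, it forces \<open>E T < 1\<close>.\<close>

lemma fixed_law_necessary:
  assumes F: "fixed_law \<mu> FT G F"
  shows "integrable G (\<lambda>x. x)" "mean G = 1" "integrable G (\<lambda>x. x\<^sup>2)"
    "integrable FT (\<lambda>t. t)" "mean FT < 1"
    "(\<integral>x. x\<^sup>2 \<partial>F) = \<mu>\<^sup>2 * (\<integral>x. x\<^sup>2 \<partial>G) + mean FT * (\<integral>x. x\<^sup>2 \<partial>F)"
proof -
  note F' = F[unfolded fixed_law_def]
  have nd: "nonneg_distribution F" and m: "integrable F (\<lambda>x. x)" and mean: "mean F = \<mu>"
    and m2: "integrable F (\<lambda>x. x\<^sup>2)"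
    and eq: "\<And>s. 0 \<le> s \<Longrightarrow> laplace_stieltjes F s = laplace_stieltjes G (sigma FT F s)"
    using F' by auto
  define u :: "nat \<Rightarrow> real" where "u n = 1 / (real n + 1)" for n
  have u_pos: "0 < u n" for n by (simp add: u_def)
  have u_lim: "u \<longlonglongrightarrow> 0" unfolding u_def by real_asymp
  define v where "v n = sigma FT F (u n)" for n
  have v_pos: "0 < v n" for n
    unfolding v_def using \<mu> by (intro sigma_pos[OF nd m FT u_pos]) (simp add: mean)
  have ratio: "(\<lambda>n. v n / u n) \<longlonglongrightarrow> \<mu>"
    unfolding v_def mean[symmetric] by (rule sigma_quotient_tendsto[OF nd m FT u_pos u_lim])
  have v_lim: "v \<longlonglongrightarrow> 0"
  proof -
    have "(\<lambda>n. v n / u n * u n) \<longlonglongrightarrow> \<mu> * 0" by (intro tendsto_mult ratio u_lim)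
    moreover have "v n / u n * u n = v n" for n using u_pos[of n] by simp
    ultimately show ?thesis by simp
  qed
  have Gv: "laplace_stieltjes G (v n) = laplace_stieltjes F (u n)" for n
    unfolding v_def using eq[of "u n"] u_pos[of n] by simp
  have lim1: "(\<lambda>n. (1 - laplace_stieltjes G (v n)) / v n) \<longlonglongrightarrow> 1"
  proof -
    have "(\<lambda>n. (1 - laplace_stieltjes F (u n)) / u n / (v n / u n)) \<longlonglongrightarrow> \<mu> / \<mu>"
      using \<mu> laplace_quotient_tendsto_mean[OF nd u_pos u_lim m] unfolding mean
      by (intro tendsto_divide ratio) auto
    moreover have "(1 - laplace_stieltjes F (u n)) / u n / (v n / u n) = (1 - laplace_stieltjes G (v n)) / v n" for n
      unfolding Gv using u_pos[of n] by simp
    moreover have "\<mu> / \<mu> = 1" using \<mu> by simp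
    ultimately show ?thesis by (simp only:)
  qed
  have bounded: "\<exists>B. \<forall>n. x n \<le> B" if "x \<longlonglongrightarrow> l" for x :: "nat \<Rightarrow> real" and l
  proof -
    have "Bseq x" using that by (intro convergent_imp_Bseq convergentI)
    from BseqD[OF this] obtain B where B: "\<forall>n. norm (x n) \<le> B" by (elim exE conjE) (rule that)
    have "\<forall>n. x n \<le> B"
    proof
      fix n
      have "norm (x n) \<le> B" using B by (rule spec)
      then show "x n \<le> B" unfolding real_norm_def by (rule abs_le_D1)
    qed
    then show ?thesis by (rule exI)
  qed
  obtain B1 where "\<And>n. (1 - laplace_stieltjes G (v n)) / v n \<le> B1"
    using bounded[OF lim1] by blast
  then show Gm: "integrable G (\<lambda>x. x)"
    by (rule integrable_of_laplace_quotient_bounded[OF G v_pos v_lim])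
  show G1: "mean G = 1"
    using laplace_quotient_tendsto_mean[OF G v_pos v_lim Gm] lim1 by (rule LIMSEQ_unique)
  define a where "a n = (laplace_stieltjes G (v n) - 1 + mean G * v n) / (v n)\<^sup>2" for n
  define b where "b n = (mean F * u n - v n) / (u n)\<^sup>2" for n
  define c where "c n = (laplace_stieltjes F (u n) - 1 + mean F * u n) / (u n)\<^sup>2" for n
  have c_eq: "c n = a n * (v n / u n)\<^sup>2 + b n" for n
  proof -
    have "a n * (v n / u n)\<^sup>2 = (laplace_stieltjes F (u n) - 1 + v n) / (u n)\<^sup>2"
      unfolding a_def G1 Gv using v_pos[of n] by (simp add: power_divide)
    then show ?thesis unfolding c_def b_def by (simp flip: add_divide_distrib)
  qed
  have c_lim: "c \<longlonglongrightarrow> (\<integral>x. x\<^sup>2 \<partial>F) / 2"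
    unfolding c_def by (rule laplace_quotient2_tendsto[OF nd u_pos u_lim m m2])
  have a_nn: "0 \<le> a n" for n
    unfolding a_def using laplace_stieltjes_taylor_bounds(1)[OF G Gm, of "v n"] v_pos[of n] by simp
  have b_nn: "0 \<le> b n" for n
    unfolding b_def v_def using sigma_bounds(2)[OF nd m FT, of "u n"] u_pos[of n] by simp
  obtain B2 where B2: "\<And>n. c n \<le> B2" using bounded[OF c_lim] by blast
  have m2_ge: "\<mu>\<^sup>2 \<le> (\<integral>x. x\<^sup>2 \<partial>F)" using second_moment_ge[OF nd m m2] by (simp add: mean)
  then have m2_pos: "0 < (\<integral>x. x\<^sup>2 \<partial>F)" using \<mu> by (meson less_le_trans zero_less_power)
  have b_le: "(mean F * u n - sigma FT F (u n)) / (u n)\<^sup>2 \<le> B2" for n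
  proof -
    have "0 \<le> a n * (v n / u n)\<^sup>2" using a_nn[of n] by simp
    then show ?thesis using c_eq[of n] B2[of n] unfolding b_def v_def by linarith
  qed
  show Tm: "integrable FT (\<lambda>t. t)"
    by (rule integrable_of_sigma_defect_bounded[OF nd m FT u_pos u_lim m2 b_le m2_pos])
  have b_lim: "b \<longlonglongrightarrow> mean FT * ((\<integral>x. x\<^sup>2 \<partial>F) / 2)"
    unfolding b_def v_def by (rule sigma_defect_tendsto[OF nd m FT u_pos u_lim m2 Tm])
  have a_eq: "a n = (c n - b n) / (v n / u n)\<^sup>2" for n
    using c_eq[of n] v_pos[of n] u_pos[of n] by simp
  have a_lim: "a \<longlonglongrightarrow> ((\<integral>x. x\<^sup>2 \<partial>F) / 2 - mean FT * ((\<integral>x. x\<^sup>2 \<partial>F) / 2)) / \<mu>\<^sup>2"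
    unfolding a_eq[abs_def] using \<mu> by (intro tendsto_divide tendsto_diff tendsto_power c_lim b_lim ratio) auto
  obtain B3 where "\<And>n. a n \<le> B3" using bounded[OF a_lim] by blast
  then show Gm2: "integrable G (\<lambda>x. x\<^sup>2)"
    unfolding a_def by (rule integrable_square_of_laplace_quotient2_bounded[OF G v_pos v_lim Gm])
  have "a \<longlonglongrightarrow> (\<integral>x. x\<^sup>2 \<partial>G) / 2"
    unfolding a_def by (rule laplace_quotient2_tendsto[OF G v_pos v_lim Gm Gm2])
  from LIMSEQ_unique[OF this a_lim]
  show main: "(\<integral>x. x\<^sup>2 \<partial>F) = \<mu>\<^sup>2 * (\<integral>x. x\<^sup>2 \<partial>G) + mean FT * (\<integral>x. x\<^sup>2 \<partial>F)"
    using \<mu> by (simp add: field_simps)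
  have "1 \<le> (\<integral>x. x\<^sup>2 \<partial>G)" using second_moment_ge[OF G Gm Gm2] by (simp add: G1)
  then have "0 < \<mu>\<^sup>2 * (\<integral>x. x\<^sup>2 \<partial>G)" using \<mu> by simp
  then have "mean FT * (\<integral>x. x\<^sup>2 \<partial>F) < 1 * (\<integral>x. x\<^sup>2 \<partial>F)" using main by linarith
  then show "mean FT < 1" using m2_pos by (simp only: mult_less_cancel_right_pos)
qed

context
  assumes Gm: "integrable G (\<lambda>x. x)" and G1: "mean G = 1" and Gm2: "integrable G (\<lambda>x. x\<^sup>2)"
    and Tm: "integrable FT (\<lambda>t. t)" and T1: "mean FT < 1"
begin

text \<open>Two transforms with the same mean differ by at most \<open>D s\<^sup>2\<close>. As the transform of \<open>G\<close> is Lipschitz with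
constant \<open>mean G = 1\<close>, applying the equation \<open>n\<close> times improves this to \<open>(E T)\<^sup>n D s\<^sup>2\<close>.\<close>

lemma fixed_law_unique:
  assumes F1: "fixed_law \<mu> FT G F1" and F2: "fixed_law \<mu> FT G F2"
  shows "F1 = F2"
proof -
  have nd1: "nonneg_distribution F1" and m1: "integrable F1 (\<lambda>x. x)" and mean1: "mean F1 = \<mu>"
    and m21: "integrable F1 (\<lambda>x. x\<^sup>2)"
    and eq1: "\<And>s. 0 \<le> s \<Longrightarrow> laplace_stieltjes F1 s = laplace_stieltjes G (sigma FT F1 s)"
    using F1 by (auto simp: fixed_law_def)
  have nd2: "nonneg_distribution F2" and m2: "integrable F2 (\<lambda>x. x)" and mean2: "mean F2 = \<mu>"
    and m22: "integrable F2 (\<lambda>x. x\<^sup>2)"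
    and eq2: "\<And>s. 0 \<le> s \<Longrightarrow> laplace_stieltjes F2 s = laplace_stieltjes G (sigma FT F2 s)"
    using F2 by (auto simp: fixed_law_def)
  define D where "D = (\<integral>x. x\<^sup>2 \<partial>F1) / 2 + (\<integral>x. x\<^sup>2 \<partial>F2) / 2"
  have iter: "\<bar>laplace_stieltjes F1 s - laplace_stieltjes F2 s\<bar> \<le> mean FT ^ n * D * s\<^sup>2" if "0 \<le> s" for n s
    using that
  proof (induction n arbitrary: s)
    case 0
    have "0 \<le> (\<integral>x. x\<^sup>2 \<partial>F1) / 2 * s\<^sup>2" "0 \<le> (\<integral>x. x\<^sup>2 \<partial>F2) / 2 * s\<^sup>2" by auto
    then show ?case
      using laplace_stieltjes_taylor_bounds(1)[OF nd1 m1 0] laplace_stieltjes_taylor_bounds(2)[OF nd1 m1 0 m21]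
        laplace_stieltjes_taylor_bounds(1)[OF nd2 m2 0] laplace_stieltjes_taylor_bounds(2)[OF nd2 m2 0 m22]
      unfolding mean1 mean2 D_def power_0 mult_1 distrib_right by linarith
  next
    case (Suc n)
    have "\<bar>laplace_stieltjes F1 s - laplace_stieltjes F2 s\<bar> \<le> \<bar>sigma FT F1 s - sigma FT F2 s\<bar>"
      using laplace_stieltjes_Lipschitz[OF G Gm sigma_bounds(1)[OF nd1 m1 FT Suc.prems] sigma_bounds(1)[OF nd2 m2 FT Suc.prems]]
      by (simp add: eq1[OF Suc.prems] eq2[OF Suc.prems] G1)
    also have "\<dots> \<le> mean FT * (mean FT ^ n * D) * s\<^sup>2"
      by (rule sigma_contraction[OF nd1 m1 nd2 m2 _ FT Tm Suc.prems Suc.IH]) (simp_all add: mean1 mean2)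
    finally show ?case by (simp add: mult.assoc)
  qed
  show ?thesis
  proof (rule laplace_stieltjes_unique[OF nd1 nd2])
    fix s :: real assume s: "0 \<le> s"
    have "(\<lambda>n. mean FT ^ n * D * s\<^sup>2) \<longlonglongrightarrow> 0 * D * s\<^sup>2"
      using T1 mean_nonneg[OF FT] by (intro tendsto_mult tendsto_const LIMSEQ_power_zero) auto
    then have "\<bar>laplace_stieltjes F1 s - laplace_stieltjes F2 s\<bar> \<le> 0 * D * s\<^sup>2"
      by (rule LIMSEQ_le_const) (use iter[OF s] in auto)
    then show "laplace_stieltjes F1 s = laplace_stieltjes F2 s" by simp
  qed
qed

text \<open>One step of the iteration turns a bound \<open>K\<close> for the second moment into
\<open>\<mu>\<^sup>2 E A\<^sup>2 + E T * K\<close>, where \<open>A\<close> has law \<open>G\<close>; the second argument of the maximum is the fixed point of this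
map, the first makes room for the point mass at \<open>\<mu>\<close>.\<close>

definition "invariant_bound = max (\<mu>\<^sup>2) (\<mu>\<^sup>2 * (\<integral>x. x\<^sup>2 \<partial>G) / (1 - mean FT))"

text \<open>These bounds say that the mean is \<open>\<mu>\<close> and control the second moment, but as pointwise inequalities between
transforms they survive passage to the limit.\<close>

definition "admissible F \<longleftrightarrow> nonneg_distribution F \<and>
   (\<forall>s\<ge>0. 0 \<le> laplace_stieltjes F s - 1 + \<mu> * s \<and>
     laplace_stieltjes F s - 1 + \<mu> * s \<le> invariant_bound / 2 * s\<^sup>2)"

lemma invariant_bound_step:
  "\<mu>\<^sup>2 * (\<integral>x. x\<^sup>2 \<partial>G) + mean FT * invariant_bound \<le> invariant_bound"
proof -
  have "\<mu>\<^sup>2 * (\<integral>x. x\<^sup>2 \<partial>G) / (1 - mean FT) \<le> invariant_bound" by (simp add: invariant_bound_def)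
  then have "\<mu>\<^sup>2 * (\<integral>x. x\<^sup>2 \<partial>G) \<le> invariant_bound * (1 - mean FT)"
    using T1 by (subst (asm) pos_divide_le_eq) auto
  then show ?thesis by (simp add: algebra_simps)
qed

lemma admissible_moments:
  assumes F: "admissible F"
  shows "nonneg_distribution F" "integrable F (\<lambda>x. x)" "mean F = \<mu>" "integrable F (\<lambda>x. x\<^sup>2)"
proof -
  have b: "0 \<le> laplace_stieltjes F s - 1 + \<mu> * s"
    "laplace_stieltjes F s - 1 + \<mu> * s \<le> invariant_bound / 2 * s\<^sup>2" if "0 \<le> s" for s
    using F that by (auto simp: admissible_def)
  show nd: "nonneg_distribution F" using F by (simp add: admissible_def)
  define u :: "nat \<Rightarrow> real" where "u n = 1 / (real n + 1)" for n
  have u_pos: "0 < u n" for n by (simp add: u_def)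
  have u_lim: "u \<longlonglongrightarrow> 0" unfolding u_def by real_asymp
  have up: "(1 - laplace_stieltjes F (u n)) / u n \<le> \<mu>" for n
    using b(1)[of "u n"] u_pos[of n] by (subst pos_divide_le_eq) auto
  show m: "integrable F (\<lambda>x. x)"
    by (rule integrable_of_laplace_quotient_bounded[OF nd u_pos u_lim up])
  have low: "\<mu> - invariant_bound / 2 * u n \<le> (1 - laplace_stieltjes F (u n)) / u n" for n
    using b(2)[of "u n"] u_pos[of n] by (subst pos_le_divide_eq) (auto simp: algebra_simps power2_eq_square)
  have "(\<lambda>n. \<mu> - invariant_bound / 2 * u n) \<longlonglongrightarrow> \<mu> - invariant_bound / 2 * 0"
    by (intro tendsto_intros u_lim)
  then have l: "(\<lambda>n. \<mu> - invariant_bound / 2 * u n) \<longlonglongrightarrow> \<mu>" by simp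
  have "(\<lambda>n. (1 - laplace_stieltjes F (u n)) / u n) \<longlonglongrightarrow> \<mu>"
    by (rule tendsto_sandwich[OF always_eventually[OF allI[OF low]] always_eventually[OF allI[OF up]] l tendsto_const])
  then show mean: "mean F = \<mu>"
    using laplace_quotient_tendsto_mean[OF nd u_pos u_lim m] by (rule LIMSEQ_unique[rotated])
  have "(laplace_stieltjes F (u n) - 1 + mean F * u n) / (u n)\<^sup>2 \<le> invariant_bound / 2" for n
    unfolding mean using b(2)[of "u n"] u_pos[of n] by (subst pos_divide_le_eq) auto
  then show "integrable F (\<lambda>x. x\<^sup>2)"
    by (rule integrable_square_of_laplace_quotient2_bounded[OF nd u_pos u_lim m])
qed

lemma admissible_return: "admissible (return borel \<mu>)"
  unfolding admissible_def
proof (intro conjI allI impI)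
  show "nonneg_distribution (return borel \<mu>)" using \<mu> by (intro nonneg_distribution_return) simp
  fix s :: real assume s: "0 \<le> s"
  have L: "laplace_stieltjes (return borel \<mu>) s = exp (- (s * \<mu>))"
    using \<mu> by (simp add: laplace_stieltjes_return)
  show "0 \<le> laplace_stieltjes (return borel \<mu>) s - 1 + \<mu> * s"
    using exp_ge_add_one_self[of "- (s * \<mu>)"] unfolding L by (simp add: mult.commute)
  have "exp (- (s * \<mu>)) \<le> 1 - s * \<mu> + (s * \<mu>)\<^sup>2 / 2"
    using s \<mu> by (intro exp_minus_le_quadratic) simp
  moreover have "(s * \<mu>)\<^sup>2 / 2 \<le> invariant_bound / 2 * s\<^sup>2"
  proof -
    have "s\<^sup>2 * \<mu>\<^sup>2 \<le> s\<^sup>2 * invariant_bound" by (intro mult_left_mono) (auto simp: invariant_bound_def)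
    then show ?thesis by (simp add: power_mult_distrib mult.commute)
  qed
  ultimately show "laplace_stieltjes (return borel \<mu>) s - 1 + \<mu> * s \<le> invariant_bound / 2 * s\<^sup>2"
    unfolding L by (simp add: mult.commute)
qed

text \<open>With \<open>\<gamma>\<close> the transform of \<open>G\<close> and \<open>K\<close> the bound, add \<open>\<gamma> \<sigma> - 1 + \<sigma> \<le> E A\<^sup>2 / 2 * (\<mu> s)\<^sup>2\<close> to \<open>\<mu> s - \<sigma> \<le> E T * K / 2 * s\<^sup>2\<close>;
the sum is at most \<open>K / 2 * s\<^sup>2\<close> by the choice of \<open>K\<close>.\<close>

lemma admissible_step:
  assumes F: "admissible F"
  shows "\<exists>H. admissible H \<and> (\<forall>s\<ge>0. laplace_stieltjes H s = laplace_stieltjes G (sigma FT F s))"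
proof -
  note nd = admissible_moments(1)[OF F] and m = admissible_moments(2)[OF F] and mean = admissible_moments(3)[OF F]
  obtain H where H: "nonneg_distribution H"
    "\<And>s. 0 \<le> s \<Longrightarrow> laplace_stieltjes H s = laplace_stieltjes G (sigma FT F s)"
    using equation_operator_exists[OF nd m G Gm FT] by blast
  have "0 \<le> laplace_stieltjes H s - 1 + \<mu> * s \<and> laplace_stieltjes H s - 1 + \<mu> * s \<le> invariant_bound / 2 * s\<^sup>2"
    if s: "0 \<le> s" for s
  proof -
    have \<sigma>: "0 \<le> sigma FT F s" "sigma FT F s \<le> \<mu> * s"
      using sigma_bounds[OF nd m FT s] by (auto simp: mean)
    have 1: "0 \<le> laplace_stieltjes G (sigma FT F s) - 1 + sigma FT F s"
      "laplace_stieltjes G (sigma FT F s) - 1 + sigma FT F s \<le> (\<integral>x. x\<^sup>2 \<partial>G) / 2 * (sigma FT F s)\<^sup>2"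
      using laplace_stieltjes_taylor_bounds(1)[OF G Gm \<sigma>(1)] laplace_stieltjes_taylor_bounds(2)[OF G Gm \<sigma>(1) Gm2]
      by (simp_all add: G1)
    have 2: "(\<integral>x. x\<^sup>2 \<partial>G) / 2 * (sigma FT F s)\<^sup>2 \<le> (\<integral>x. x\<^sup>2 \<partial>G) / 2 * (\<mu> * s)\<^sup>2"
      using \<sigma> by (intro mult_left_mono power_mono) auto
    have 3: "\<mu> * s - sigma FT F s \<le> mean FT * (invariant_bound / 2 * s\<^sup>2)"
      using F sigma_defect_le[OF nd m FT s _ Tm, of invariant_bound] by (simp add: admissible_def mean)
    have "(\<mu>\<^sup>2 * (\<integral>x. x\<^sup>2 \<partial>G) + mean FT * invariant_bound) * (s\<^sup>2 / 2) \<le> invariant_bound * (s\<^sup>2 / 2)"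
      by (intro mult_right_mono invariant_bound_step) auto
    then have 4: "(\<integral>x. x\<^sup>2 \<partial>G) / 2 * (\<mu> * s)\<^sup>2 + mean FT * (invariant_bound / 2 * s\<^sup>2) \<le> invariant_bound / 2 * s\<^sup>2"
      by (simp add: algebra_simps power_mult_distrib)
    show ?thesis using \<sigma> 1 2 3 4 unfolding H(2)[OF s] by linarith
  qed
  with H show ?thesis unfolding admissible_def by blast
qed

text \<open>Iterate from the point mass at \<open>\<mu>\<close>. The first iterate has a larger transform by Jensen's inequality, and the
step is monotone (a larger transform gives a smaller \<open>\<sigma>\<close>, hence again a larger transform), so the
transforms increase and converge. The limit is an admissible law, and the equation passes to the limit.\<close>

lemma fixed_law_exists: "\<exists>F. fixed_law \<mu> FT G F"
proof -
  have "\<exists>F. \<forall>n. (admissible (F n) \<and> (n = 0 \<longrightarrow> F n = return borel \<mu>)) \<and>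
      (\<forall>s\<ge>0. laplace_stieltjes (F (Suc n)) s = laplace_stieltjes G (sigma FT (F n) s))"
    by (rule dependent_nat_choice) (use admissible_return admissible_step in auto)
  then obtain F where adm: "\<And>n. admissible (F n)" and F0: "F 0 = return borel \<mu>"
    and step: "\<And>n s. 0 \<le> s \<Longrightarrow> laplace_stieltjes (F (Suc n)) s = laplace_stieltjes G (sigma FT (F n) s)"
    by blast
  note nd = admissible_moments(1)[OF adm] and m = admissible_moments(2)[OF adm] and mean = admissible_moments(3)[OF adm]
  have mono: "laplace_stieltjes (F n) s \<le> laplace_stieltjes (F (Suc n)) s" if "0 \<le> s" for n s
    using that
  proof (induction n arbitrary: s)
    case 0
    show ?case
      using exp_mean_le_laplace_stieltjes[OF nd[of 1] m[of 1] 0] \<mu>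
      by (simp add: mean F0 laplace_stieltjes_return)
  next
    case (Suc n)
    have "sigma FT (F (Suc n)) s \<le> sigma FT (F n) s"
      by (rule sigma_antimono[OF nd m nd m _ FT Suc.prems Suc.IH]) (simp_all add: mean)
    then show ?case
      unfolding step[OF Suc.prems]
      by (intro laplace_stieltjes_antimono[OF G] sigma_bounds(1)[OF nd m FT Suc.prems])
  qed
  define \<phi> where "\<phi> s = lim (\<lambda>n. laplace_stieltjes (F n) s)" for s
  have lim: "(\<lambda>n. laplace_stieltjes (F n) s) \<longlonglongrightarrow> \<phi> s" if s: "0 \<le> s" for s
  proof -
    have "incseq (\<lambda>n. laplace_stieltjes (F n) s)" using mono[OF s] by (intro incseq_SucI)
    then obtain L where "(\<lambda>n. laplace_stieltjes (F n) s) \<longlonglongrightarrow> L"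
      using incseq_convergent[of _ 1] laplace_stieltjes_bounds(2)[OF nd s] by blast
    then show ?thesis unfolding \<phi>_def by (simp add: limI)
  qed
  have tight: "1 - laplace_stieltjes (F n) s \<le> \<mu> * s" if "0 \<le> s" for n s
    using one_minus_laplace_stieltjes_le[OF nd m that, of n] by (simp add: mean)
  obtain H where H: "nonneg_distribution H" and H_eq: "\<And>s. 0 \<le> s \<Longrightarrow> laplace_stieltjes H s = \<phi> s"
    using laplace_stieltjes_continuity[of F \<phi> \<mu>, OF nd lim tight] by blast
  have H_lim: "(\<lambda>n. laplace_stieltjes (F n) s) \<longlonglongrightarrow> laplace_stieltjes H s" if "0 \<le> s" for s
    using lim[OF that] H_eq[OF that] by simp
  have H_adm: "admissible H"
    unfolding admissible_def
  proof (intro conjI allI impI H)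
    fix s :: real assume s: "0 \<le> s"
    have "(\<lambda>n. laplace_stieltjes (F n) s - 1 + \<mu> * s) \<longlonglongrightarrow> laplace_stieltjes H s - 1 + \<mu> * s"
      by (intro tendsto_intros H_lim s)
    moreover have "0 \<le> laplace_stieltjes (F n) s - 1 + \<mu> * s"
      "laplace_stieltjes (F n) s - 1 + \<mu> * s \<le> invariant_bound / 2 * s\<^sup>2" for n
      using adm[of n] s unfolding admissible_def by blast+
    ultimately show "0 \<le> laplace_stieltjes H s - 1 + \<mu> * s"
      "laplace_stieltjes H s - 1 + \<mu> * s \<le> invariant_bound / 2 * s\<^sup>2"
      by (blast intro: LIMSEQ_le_const LIMSEQ_le_const2)+
  qed
  note Hm = admissible_moments[OF H_adm]
  have "laplace_stieltjes H s = laplace_stieltjes G (sigma FT H s)" if s: "0 \<le> s" for s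
  proof (rule LIMSEQ_unique)
    show "(\<lambda>n. laplace_stieltjes (F (Suc n)) s) \<longlonglongrightarrow> laplace_stieltjes H s"
      using H_lim[OF s] by (rule LIMSEQ_Suc)
    have "(\<lambda>n. sigma FT (F n) s) \<longlonglongrightarrow> sigma FT H s"
      by (rule sigma_tendsto[OF nd m mean Hm(1-3) FT s H_lim])
    then show "(\<lambda>n. laplace_stieltjes (F (Suc n)) s) \<longlonglongrightarrow> laplace_stieltjes G (sigma FT H s)"
      unfolding step[OF s]
      by (intro laplace_stieltjes_tendsto[OF G Gm] sigma_bounds(1)[OF nd m FT s])
  qed
  then have "fixed_law \<mu> FT G H" unfolding fixed_law_def using Hm by blast
  then show ?thesis by blast
qed

end

theorem unique_fixed_law_iff:
  "(\<exists>!F. fixed_law \<mu> FT G F) \<longleftrightarrow>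
    integrable FT (\<lambda>t. t) \<and> mean FT < 1 \<and>
    integrable G (\<lambda>x. x) \<and> mean G = 1 \<and> integrable G (\<lambda>x. x\<^sup>2)"
proof
  assume "\<exists>!F. fixed_law \<mu> FT G F"
  then obtain F where "fixed_law \<mu> FT G F" by blast
  from fixed_law_necessary[OF this]
  show "integrable FT (\<lambda>t. t) \<and> mean FT < 1 \<and>
    integrable G (\<lambda>x. x) \<and> mean G = 1 \<and> integrable G (\<lambda>x. x\<^sup>2)" by blast
next
  assume "integrable FT (\<lambda>t. t) \<and> mean FT < 1 \<and>
    integrable G (\<lambda>x. x) \<and> mean G = 1 \<and> integrable G (\<lambda>x. x\<^sup>2)"
  then show "\<exists>!F. fixed_law \<mu> FT G F"
    using fixed_law_exists fixed_law_unique by blast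
qed

theorem fixed_law_variance:
  assumes F: "fixed_law \<mu> FT G F"
  shows "prob_space.variance F (\<lambda>x. x) =
    ((\<integral>x. x\<^sup>2 \<partial>G) - 1 + mean FT) / (1 - mean FT) * \<mu>\<^sup>2"
proof -
  have nd: "nonneg_distribution F" and m: "integrable F (\<lambda>x. x)" and mean: "mean F = \<mu>"
    and m2: "integrable F (\<lambda>x. x\<^sup>2)"
    using F by (auto simp: fixed_law_def)
  interpret prob_space F using nd by (rule nonneg_distributionD)
  have "(\<integral>x. x\<^sup>2 \<partial>F) = \<mu>\<^sup>2 * (\<integral>x. x\<^sup>2 \<partial>G) / (1 - mean FT)"
    using fixed_law_necessary(5,6)[OF F] by (simp add: field_simps)
  moreover have "variance (\<lambda>x. x) = (\<integral>x. x\<^sup>2 \<partial>F) - \<mu>\<^sup>2"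
    using variance_eq[OF m m2] mean by (simp add: mean_def)
  moreover have "c * x / (1 - t) - c = (x - 1 + t) / (1 - t) * c" if "t < 1" for c x t :: real
    using that by (simp add: field_simps)
  ultimately show ?thesis
    using fixed_law_necessary(5)[OF F] by simp
qed

end

section \<open>The zeta function and the law of \<open>\<Lambda>\<close> times the logarithm of a zeta variable\<close>

text \<open>\<open>(- 1)\<^sup>k\<close> times the \<open>k\<close>-th derivative of \<open>\<zeta>\<close>; after division by \<open>\<zeta>(s)\<close>, the \<open>k\<close>-th moment of \<open>log N\<close> when
\<open>N = n\<close> with probability \<open>n\<^sup>-\<^sup>s / \<zeta>(s)\<close>.\<close>

definition zeta_log_moment :: "nat \<Rightarrow> real \<Rightarrow> real" where
  "zeta_log_moment k s = (\<Sum>n. ln (real (Suc n)) ^ k * real (Suc n) powr (- s))"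

lemma zeta_eq_log_moment_0: "zeta = zeta_log_moment 0"
  by (simp add: fun_eq_iff zeta_def zeta_log_moment_def)

lemma summable_zeta_log_moment:
  assumes s: "1 < s"
  shows "summable (\<lambda>n. ln (real (Suc n)) ^ k * real (Suc n) powr (- s))"
proof -
  \<comment> \<open>small enough for \<open>ln n \<le> n powr e / e\<close> to leave an exponent \<open>b \<ge> (s + 1) / 2\<close>\<close>
  define e where "e = (s - 1) / (2 * (real k + 1))"
  define b where "b = s - real k * e"
  have e: "0 < e" using s by (simp add: e_def)
  have "real k * e \<le> (real k + 1) * e" using e by (simp add: mult_right_mono)
  also have "\<dots> = (s - 1) / 2" by (simp add: e_def field_simps)
  finally have b: "1 < b" using s by (simp add: b_def)
  have "summable (\<lambda>n. real (Suc n) powr (- b))"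
    using b by (subst summable_Suc_iff) (simp add: summable_real_powr_iff)
  then have summ: "summable (\<lambda>n. 1 / e ^ k * real (Suc n) powr (- b))" by (rule summable_mult)
  show ?thesis
  proof (rule summable_comparison_test'[OF summ, of 0])
    fix n :: nat
    have x: "1 \<le> real (Suc n)" by simp
    have "ln (real (Suc n)) ^ k \<le> (real (Suc n) powr e / e) ^ k"
      using ln_powr_bound[OF x e] by (intro power_mono) auto
    also have "\<dots> = 1 / e ^ k * real (Suc n) powr (real k * e)"
      using x by (simp add: power_divide powr_power mult.commute)
    finally have "ln (real (Suc n)) ^ k * real (Suc n) powr (- s)
        \<le> 1 / e ^ k * real (Suc n) powr (real k * e) * real (Suc n) powr (- s)"
      by (intro mult_right_mono) auto
    also have "\<dots> = 1 / e ^ k * real (Suc n) powr (- b)"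
      by (simp add: b_def flip: powr_add)
    finally show "norm (ln (real (Suc n)) ^ k * real (Suc n) powr (- s)) \<le> 1 / e ^ k * real (Suc n) powr (- b)"
      by simp
  qed
qed

lemma sums_zeta_log_moment:
  "1 < s \<Longrightarrow> (\<lambda>n. ln (real (Suc n)) ^ k * real (Suc n) powr (- s)) sums zeta_log_moment k s"
  unfolding zeta_log_moment_def by (rule summable_sums[OF summable_zeta_log_moment])

lemma zeta_log_moment_pos:
  assumes s: "1 < s" shows "0 < zeta_log_moment k s"
  unfolding zeta_log_moment_def
  by (rule suminf_pos2[OF summable_zeta_log_moment[OF s], of _ 1]) auto

text \<open>Termwise differentiation; on \<open>x > c > 1\<close> the differentiated series is dominated by its value at \<open>c\<close>.\<close>

lemma has_derivative_zeta_log_moment: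
  assumes s: "1 < s"
  shows "(zeta_log_moment k has_real_derivative - zeta_log_moment (Suc k) s) (at s)"
proof -
  define c where "c = (1 + s) / 2"
  have c: "1 < c" "c < s" using s by (auto simp: c_def)
  let ?f = "\<lambda>n x. ln (real (Suc n)) ^ k * real (Suc n) powr (- x)"
  let ?f' = "\<lambda>n x. - (ln (real (Suc n)) ^ Suc k * real (Suc n) powr (- x))"
  have "((\<lambda>x. \<Sum>n. ?f n x) has_field_derivative (\<Sum>n. ?f' n s)) (at s)"
  proof (rule has_field_derivative_series'(2)[where S = "{c<..}" and ?x0.0 = s])
    show "(?f n has_field_derivative ?f' n x) (at x within {c<..})" for n x
      by (auto simp: powr_def intro!: derivative_eq_intros)
    show "uniformly_convergent_on {c<..} (\<lambda>n x. \<Sum>i<n. ?f' i x)"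
    proof (rule Weierstrass_m_test'[OF _ summable_zeta_log_moment[OF c(1), of "Suc k"]])
      fix n x assume "x \<in> {c<..}"
      then have "real (Suc n) powr (- x) \<le> real (Suc n) powr (- c)" by (intro powr_mono) auto
      then show "norm (?f' n x) \<le> ln (real (Suc n)) ^ Suc k * real (Suc n) powr (- c)"
        by (simp add: abs_mult mult_left_mono del: of_nat_Suc power_Suc)
    qed
    show "s \<in> {c<..}" "s \<in> interior {c<..}" using c by (auto simp: interior_open)
  qed (use summable_zeta_log_moment[OF s] in auto)
  also have "(\<Sum>n. ?f' n s) = - zeta_log_moment (Suc k) s"
    unfolding zeta_log_moment_def by (rule suminf_minus[OF summable_zeta_log_moment[OF s]])
  finally show ?thesis by (simp add: zeta_log_moment_def[abs_def])
qed

lemma deriv_zeta: "1 < s \<Longrightarrow> deriv zeta s = - zeta_log_moment 1 s"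
  unfolding zeta_eq_log_moment_0 using has_derivative_zeta_log_moment[of s 0] by (intro DERIV_imp_deriv) simp

lemma deriv_deriv_zeta:
  assumes "1 < s" shows "deriv (deriv zeta) s = zeta_log_moment 2 s"
proof (rule DERIV_imp_deriv)
  have "((\<lambda>x. - zeta_log_moment 1 x) has_real_derivative zeta_log_moment 2 s) (at s)"
    using DERIV_minus[OF has_derivative_zeta_log_moment[OF assms, of 1]] by (simp add: numeral_2_eq_2)
  then show "(deriv zeta has_real_derivative zeta_log_moment 2 s) (at s)"
    by (rule has_field_derivative_transform_within_open[of _ _ _ "{1<..}"]) (use assms in \<open>auto simp: deriv_zeta\<close>)
qed

lemma borel_measurable_zeta [measurable]: "zeta \<in> borel_measurable borel"
  unfolding zeta_def[abs_def] by measurable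

lemma integrable_iff_nn_integral_finite:
  assumes "f \<in> borel_measurable M" "AE x in M. 0 \<le> f x"
  shows "integrable M f \<longleftrightarrow> (\<integral>\<^sup>+x. ennreal (f x) \<partial>M) < \<infinity>"
  using assms nn_integral_eq_integral[of M f] by (auto intro: integrableI_nonneg)

text \<open>The hypothesis is about extended nonnegative integrals because it is used for moments that may be infinite;
their finiteness is part of what is transferred.\<close>

lemma integral_eq_of_nn_integral_eq:
  assumes f: "f \<in> borel_measurable M" "AE x in M. 0 \<le> f x" and g: "g \<in> borel_measurable N" "AE x in N. 0 \<le> g x"
    and c: "0 < c" and eq: "(\<integral>\<^sup>+x. ennreal (f x) \<partial>M) = ennreal c * (\<integral>\<^sup>+x. ennreal (g x) \<partial>N)"
  shows "integrable M f \<longleftrightarrow> integrable N g" "(\<integral>x. f x \<partial>M) = c * (\<integral>x. g x \<partial>N)"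
proof -
  show "integrable M f \<longleftrightarrow> integrable N g"
    unfolding integrable_iff_nn_integral_finite[OF f] integrable_iff_nn_integral_finite[OF g] eq
    using c by (auto simp: ennreal_mult_less_top)
  show "(\<integral>x. f x \<partial>M) = c * (\<integral>x. g x \<partial>N)"
    using c by (simp add: integral_eq_nn_integral[OF f] integral_eq_nn_integral[OF g] eq enn2real_mult)
qed

text \<open>\<open>G\<close> is the law of \<open>\<Lambda> log N\<close>, with \<open>N\<close> independent of \<open>\<Lambda>\<close> and equal to \<open>n\<close> with probability
\<open>n\<^sup>-\<^sup>a / \<zeta>(a)\<close>. The formula for its transform is \<open>\<zeta>(a + \<lambda> x) = \<Sum>n. n\<^sup>-\<^sup>a exp (- x \<lambda> log n)\<close>, and its moments
factor by independence.\<close>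

lemma zeta_mixture_exists:
  assumes a: "1 < a" and FL: "nonneg_distribution FL"
  obtains G where "nonneg_distribution G"
    "\<And>x. 0 \<le> x \<Longrightarrow> laplace_stieltjes G x = 1 / zeta a * (LINT l:{0..}|FL. zeta (a + l * x))"
    "\<And>j. (\<integral>\<^sup>+x. ennreal (x ^ j) \<partial>G) = ennreal (zeta_log_moment j a / zeta a) * (\<integral>\<^sup>+l. ennreal (l ^ j) \<partial>FL)"
proof -
  interpret FL: real_distribution FL using FL by (rule nonneg_distributionD)
  have z: "0 < zeta a" using zeta_log_moment_pos[OF a, of 0] by (simp add: zeta_eq_log_moment_0)
  define q where "q n = real (Suc n) powr (- a) / zeta a" for n
  have q_nn: "0 \<le> q n" for n using z by (simp add: q_def)
  have q_ln_sums: "(\<lambda>n. q n * ln (real (Suc n)) ^ j) sums (zeta_log_moment j a / zeta a)" for j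
    using sums_divide[OF sums_zeta_log_moment[OF a, of j], of "zeta a"]
    by (simp add: q_def mult.commute)
  have q_sums: "q sums 1"
    using q_ln_sums[of 0] z by (simp add: zeta_eq_log_moment_0)
  define K where "K n = distr FL borel (\<lambda>l. l * ln (real (Suc n)))" for n
  have K: "nonneg_distribution (K n)" for n
    unfolding K_def
  proof (rule nonneg_distribution_distr[OF FL.prob_space_axioms])
    show "AE l in FL. 0 \<le> l * ln (real (Suc n))"
      using nonneg_distributionD(7)[OF FL] by eventually_elim simp
  qed measurable
  obtain G where G: "nonneg_distribution G"
    and int: "\<forall>f\<in>borel_measurable borel. (\<integral>\<^sup>+x. f x \<partial>G) = (\<Sum>n. ennreal (q n) * (\<integral>\<^sup>+x. f x \<partial>K n))"
    using mixture_exists[of q K, OF q_nn q_sums K] by blast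
  show ?thesis
  proof (rule that[OF G])
    fix x :: real assume x: "0 \<le> x"
    have "(\<lambda>n. q n * laplace_stieltjes (K n) x) sums laplace_stieltjes G x"
      using q_nn K G int x by (rule laplace_stieltjes_mixture)
    moreover have "q n * laplace_stieltjes (K n) x = 1 / zeta a * (\<integral>l. real (Suc n) powr (- (a + l * x)) \<partial>FL)" for n
    proof -
      have "laplace_stieltjes (K n) x = (\<integral>l. exp (- x * (l * ln (real (Suc n)))) \<partial>FL)"
        unfolding laplace_stieltjes_eq[OF K] unfolding K_def by (rule integral_distr) measurable
      then have "real (Suc n) powr (- a) * laplace_stieltjes (K n) x
          = (\<integral>l. real (Suc n) powr (- a) * exp (- x * (l * ln (real (Suc n)))) \<partial>FL)"
        by (simp del: of_nat_Suc)
      also have "\<dots> = (\<integral>l. real (Suc n) powr (- (a + l * x)) \<partial>FL)"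
        by (rule Bochner_Integration.integral_cong) (auto simp: powr_def algebra_simps simp flip: exp_add)
      finally show ?thesis by (simp add: q_def del: of_nat_Suc)
    qed
    ultimately have s1: "(\<lambda>n. 1 / zeta a * (\<integral>l. real (Suc n) powr (- (a + l * x)) \<partial>FL)) sums laplace_stieltjes G x"
      by (simp only:)
    have le: "real (Suc n) powr (- (a + l * x)) \<le> real (Suc n) powr (- a)" if "0 \<le> l" for l n
      using that x by (intro powr_mono) auto
    have summ: "summable (\<lambda>n. real (Suc n) powr (- a))"
      using summable_zeta_log_moment[OF a, of 0] by simp
    have int: "integrable FL (\<lambda>l. real (Suc n) powr (- (a + l * x)))" for n
      by (rule nonneg_distribution_integrable_bounded[OF FL, where B = "real (Suc n) powr (- a)"]) (use le in auto)
    have "(\<lambda>n. \<integral>l. real (Suc n) powr (- (a + l * x)) \<partial>FL) sums (\<integral>l. (\<Sum>n. real (Suc n) powr (- (a + l * x))) \<partial>FL)"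
    proof (rule sums_integral[OF int])
      show "AE l in FL. summable (\<lambda>n. norm (real (Suc n) powr (- (a + l * x))))"
        using nonneg_distributionD(7)[OF FL]
      proof eventually_elim
        fix l :: real assume "0 \<le> l"
        then show "summable (\<lambda>n. norm (real (Suc n) powr (- (a + l * x))))"
          using le by (intro summable_comparison_test'[OF summ, of 0]) auto
      qed
      show "summable (\<lambda>n. \<integral>l. norm (real (Suc n) powr (- (a + l * x))) \<partial>FL)"
      proof (rule summable_comparison_test'[OF summ, of 0])
        fix n :: nat
        have "(\<integral>l. norm (real (Suc n) powr (- (a + l * x))) \<partial>FL) \<le> (\<integral>l. real (Suc n) powr (- a) \<partial>FL)"
        proof (rule integral_mono_AE[OF integrable_norm[OF int]])
          show "AE l in FL. norm (real (Suc n) powr (- (a + l * x))) \<le> real (Suc n) powr (- a)"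
            using nonneg_distributionD(7)[OF FL] by eventually_elim (use le in auto)
        qed simp
        then show "norm (\<integral>l. norm (real (Suc n) powr (- (a + l * x))) \<partial>FL) \<le> real (Suc n) powr (- a)"
          by (simp add: FL.prob_space[simplified] del: of_nat_Suc)
      qed
    qed
    then have "(\<lambda>n. 1 / zeta a * (\<integral>l. real (Suc n) powr (- (a + l * x)) \<partial>FL)) sums (1 / zeta a * (\<integral>l. zeta (a + l * x) \<partial>FL))"
      unfolding zeta_def[of "a + _ * x"] by (rule sums_mult)
    with s1 have "laplace_stieltjes G x = 1 / zeta a * (\<integral>l. zeta (a + l * x) \<partial>FL)" by (rule sums_unique2)
    also have "(\<integral>l. zeta (a + l * x) \<partial>FL) = (LINT l:{0..}|FL. zeta (a + l * x))"
      by (rule set_integral_nonneg_distribution[OF FL, symmetric]) measurable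
    finally show "laplace_stieltjes G x = 1 / zeta a * (LINT l:{0..}|FL. zeta (a + l * x))" .
  next
    fix j :: nat
    have K_int: "(\<integral>\<^sup>+x. ennreal (x ^ j) \<partial>K n) = ennreal (ln (real (Suc n)) ^ j) * (\<integral>\<^sup>+l. ennreal (l ^ j) \<partial>FL)" for n
    proof -
      have "(\<integral>\<^sup>+x. ennreal (x ^ j) \<partial>K n) = (\<integral>\<^sup>+l. ennreal ((l * ln (real (Suc n))) ^ j) \<partial>FL)"
        unfolding K_def by (rule nn_integral_distr) measurable
      also have "\<dots> = (\<integral>\<^sup>+l. ennreal (ln (real (Suc n)) ^ j) * ennreal (l ^ j) \<partial>FL)"
      proof (rule nn_integral_cong)
        fix l
        have "(l * ln (real (Suc n))) ^ j = ln (real (Suc n)) ^ j * l ^ j"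
          by (simp only: power_mult_distrib mult.commute)
        then show "ennreal ((l * ln (real (Suc n))) ^ j) = ennreal (ln (real (Suc n)) ^ j) * ennreal (l ^ j)"
          by (simp add: ennreal_mult' del: of_nat_Suc)
      qed
      also have "\<dots> = ennreal (ln (real (Suc n)) ^ j) * (\<integral>\<^sup>+l. ennreal (l ^ j) \<partial>FL)"
        by (rule nn_integral_cmult) measurable
      finally show ?thesis .
    qed
    have "(\<integral>\<^sup>+x. ennreal (x ^ j) \<partial>G) = (\<Sum>n. ennreal (q n) * (\<integral>\<^sup>+x. ennreal (x ^ j) \<partial>K n))"
      by (rule int[rule_format]) measurable
    also have "\<dots> = (\<Sum>n. ennreal (q n * ln (real (Suc n)) ^ j) * (\<integral>\<^sup>+l. ennreal (l ^ j) \<partial>FL))"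
      unfolding K_int using q_nn by (simp add: ennreal_mult mult.assoc del: of_nat_Suc)
    also have "\<dots> = (\<Sum>n. ennreal (q n * ln (real (Suc n)) ^ j)) * (\<integral>\<^sup>+l. ennreal (l ^ j) \<partial>FL)"
      by (rule ennreal_suminf_multc)
    also have "(\<Sum>n. ennreal (q n * ln (real (Suc n)) ^ j)) = ennreal (zeta_log_moment j a / zeta a)"
      by (rule suminf_ennreal_eq[OF _ q_ln_sums]) (use q_nn in auto)
    finally show "(\<integral>\<^sup>+x. ennreal (x ^ j) \<partial>G) = ennreal (zeta_log_moment j a / zeta a) * (\<integral>\<^sup>+l. ennreal (l ^ j) \<partial>FL)" .
  qed
qed

lemma is_solution_iff_fixed_law:
  assumes FT: "nonneg_distribution FT"
    and G: "\<And>x. 0 \<le> x \<Longrightarrow> laplace_stieltjes G x = 1 / zeta a * (LINT l:{0..}|FL. zeta (a + l * x))"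
  shows "is_solution a \<mu> FT FL F \<longleftrightarrow> fixed_law \<mu> FT G F"
proof -
  have "laplace_stieltjes G (sigma FT F s) = 1 / zeta a * (LINT l:{0..}|FL. zeta (a + l * sigma FT F s))"
    if "nonneg_distribution F" "integrable F (\<lambda>x. x)" "0 \<le> s" for s
    by (rule G[OF sigma_bounds(1)[OF that(1,2) FT that(3)]])
  then show ?thesis
    unfolding is_solution_def fixed_law_def satisfies_equation_def by auto
qed

theorem theorem5:
  fixes \<mu> a :: real and M :: "'w measure" and T L :: "'w \<Rightarrow> real"
  assumes "0 < \<mu>" and "1 < a"
    and "prob_space M"
    and "T \<in> borel_measurable M" and "AE w in M. 0 \<le> T w"
    and "L \<in> borel_measurable M" and "AE w in M. 0 \<le> L w"
  shows "((integrable M T \<and> 0 \<le> prob_space.expectation M T \<and> prob_space.expectation M T < 1 \<and>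
           integrable M L \<and> prob_space.expectation M L = - zeta a / deriv zeta a \<and>
           integrable M (\<lambda>w. (L w)\<^sup>2))
          \<longleftrightarrow> (\<exists>!F. is_solution a \<mu> (distr M borel T) (distr M borel L) F))
       \<and> ((\<exists>!F. is_solution a \<mu> (distr M borel T) (distr M borel L) F) \<longrightarrow>
           (\<forall>F. is_solution a \<mu> (distr M borel T) (distr M borel L) F \<longrightarrow>
             prob_space.variance F (\<lambda>x. x) =
               (deriv (deriv zeta) a * prob_space.expectation M (\<lambda>w. (L w)\<^sup>2)
                  - zeta a + zeta a * prob_space.expectation M T)
               / (zeta a * (1 - prob_space.expectation M T)) * \<mu>\<^sup>2))"
proof -
  define FT where "FT = distr M borel T"
  define FL where "FL = distr M borel L"
  have FT: "nonneg_distribution FT" and FL: "nonneg_distribution FL"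
    unfolding FT_def FL_def using assms by (auto intro: nonneg_distribution_distr)
  have z: "0 < zeta a" "0 < zeta_log_moment 1 a" "0 < zeta_log_moment 2 a"
    using zeta_log_moment_pos[OF \<open>1 < a\<close>] by (auto simp: zeta_eq_log_moment_0)
  obtain G where G: "nonneg_distribution G"
    and G_laplace: "\<And>x. 0 \<le> x \<Longrightarrow> laplace_stieltjes G x = 1 / zeta a * (LINT l:{0..}|FL. zeta (a + l * x))"
    and G_nn: "\<And>j. (\<integral>\<^sup>+x. ennreal (x ^ j) \<partial>G) = ennreal (zeta_log_moment j a / zeta a) * (\<integral>\<^sup>+l. ennreal (l ^ j) \<partial>FL)"
    using zeta_mixture_exists[OF \<open>1 < a\<close> FL] by blast
  have moment: "integrable G (\<lambda>x. x ^ j) \<longleftrightarrow> integrable M (\<lambda>w. L w ^ j)"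
      "(\<integral>x. x ^ j \<partial>G) = zeta_log_moment j a / zeta a * (\<integral>w. L w ^ j \<partial>M)" for j
  proof -
    have pos: "0 < zeta_log_moment j a / zeta a" using z zeta_log_moment_pos[OF \<open>1 < a\<close>] by simp
    have AE_G: "AE x in G. 0 \<le> x ^ j" and AE_L: "AE w in M. 0 \<le> L w ^ j"
      using nonneg_distributionD(7)[OF G] \<open>AE w in M. 0 \<le> L w\<close> by (auto elim!: eventually_mono)
    have meas_G: "(\<lambda>x. x ^ j) \<in> borel_measurable G"
      by (rule nonneg_distribution_measurable[OF G]) measurable
    have meas_L: "(\<lambda>w. L w ^ j) \<in> borel_measurable M" using assms by measurable
    have "(\<integral>\<^sup>+l. ennreal (l ^ j) \<partial>FL) = (\<integral>\<^sup>+w. ennreal (L w ^ j) \<partial>M)"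
      unfolding FL_def using \<open>L \<in> borel_measurable M\<close> by (rule nn_integral_distr) measurable
    from integral_eq_of_nn_integral_eq[OF meas_G AE_G meas_L AE_L pos G_nn[of j, unfolded this]]
    show "integrable G (\<lambda>x. x ^ j) \<longleftrightarrow> integrable M (\<lambda>w. L w ^ j)"
      "(\<integral>x. x ^ j \<partial>G) = zeta_log_moment j a / zeta a * (\<integral>w. L w ^ j \<partial>M)" .
  qed
  have T_int: "integrable FT (\<lambda>t. t) \<longleftrightarrow> integrable M T" and T_mean: "mean FT = (\<integral>w. T w \<partial>M)"
    unfolding FT_def mean_def using assms by (auto simp: integrable_distr_eq integral_distr)
  have T_nn: "0 \<le> (\<integral>w. T w \<partial>M)" using assms by (intro integral_nonneg_AE)
  have G_mean: "mean G = 1 \<longleftrightarrow> (\<integral>w. L w \<partial>M) = - zeta a / deriv zeta a"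
    using moment(2)[of 1] z unfolding mean_def deriv_zeta[OF \<open>1 < a\<close>] by (auto simp: field_simps)
  have iff: "is_solution a \<mu> FT FL F \<longleftrightarrow> fixed_law \<mu> FT G F" for F
    by (rule is_solution_iff_fixed_law[OF FT G_laplace])
  show ?thesis
    unfolding FT_def[symmetric] FL_def[symmetric] iff
  proof (intro conjI impI allI)
    show "(integrable M T \<and> 0 \<le> (\<integral>w. T w \<partial>M) \<and> (\<integral>w. T w \<partial>M) < 1 \<and>
           integrable M L \<and> (\<integral>w. L w \<partial>M) = - zeta a / deriv zeta a \<and>
           integrable M (\<lambda>w. (L w)\<^sup>2)) \<longleftrightarrow> (\<exists>!F. fixed_law \<mu> FT G F)"
      unfolding unique_fixed_law_iff[OF \<open>0 < \<mu>\<close> FT G] T_int T_mean G_mean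
      using moment(1)[of 1] moment(1)[of 2] T_nn by auto
    fix F assume F: "fixed_law \<mu> FT G F"
    have \<theta>: "(\<integral>w. T w \<partial>M) < 1"
      using fixed_law_necessary(5)[OF \<open>0 < \<mu>\<close> FT G F] by (simp add: T_mean)
    have alg: "(y / x * e - 1 + t) / (1 - t) = (y * e - x + x * t) / (x * (1 - t))" if "0 < x" "t < 1" for x y e t :: real
      using that by (simp add: field_simps)
    show "prob_space.variance F (\<lambda>x. x) =
        (deriv (deriv zeta) a * (\<integral>w. (L w)\<^sup>2 \<partial>M) - zeta a + zeta a * (\<integral>w. T w \<partial>M))
          / (zeta a * (1 - (\<integral>w. T w \<partial>M))) * \<mu>\<^sup>2"
      unfolding fixed_law_variance[OF \<open>0 < \<mu>\<close> FT G F] T_mean moment(2) deriv_deriv_zeta[OF \<open>1 < a\<close>]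
        alg[OF z(1) \<theta>] ..
  qed
qed

end
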